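(* For every positive integer $g$, let $$\underline{\beta}_g=\liminf_{n\to\infty}\frac{\beta_g(n)}{\sqrt n},\qquad \overline{\beta}_g=\limsup_{n\to\infty}\frac{\beta_g(n)}{\sqrt n}.$$ Then $$\lim_{g\to\infty}\frac{\underline{\beta}_g}{\sqrt g}=\lim_{g\to\infty}\frac{\overline{\beta}_g}{\sqrt g}=\sigma .$$ (In particular both limits exist.)
   Context: For a set $A$ of integers, its representation function is $r(x)=\#\{(a_1,a_2): a_1,a_2\in A,\ a_1+a_2=x\}$ (ordered pairs). $A$ is a $g$-Sidon set if $r(x)\le g$ for all $x$. For a positive integer $n$, $\beta_g(n)$ is the maximum of $|A|$ over all $g$-Sidon sets $A\subseteq\{1,\dots,n\}$. The constant $\sigma$ is defined as $\sigma=\sup\int_0^1 f(x)\,dx$, where the supremum is over all nonnegative real (integrable) functions $f$ with $f(x)=0$ for $x\notin[0,1]$ and $\int_0^1 f(t)f(x-t)\,dt\le 1$ for all real $x$. *)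

theory Defs
  imports "HOL-Analysis.Analysis"
begin

definition rep_pairs :: "int set \<Rightarrow> int \<Rightarrow> (int \<times> int) set" where
  "rep_pairs A x = {(a1, a2). a1 \<in> A \<and> a2 \<in> A \<and> a1 + a2 = x}"

definition rep :: "int set \<Rightarrow> int \<Rightarrow> nat" where
  "rep A x = card (rep_pairs A x)"

(* Finiteness is explicit because card is 0 on infinite sets. *)
definition sidon :: "nat \<Rightarrow> int set \<Rightarrow> bool" where
  "sidon g A \<longleftrightarrow> (\<forall>x. finite (rep_pairs A x) \<and> rep A x \<le> g)"

definition beta :: "nat \<Rightarrow> nat \<Rightarrow> nat" where
  "beta g n = Max {card A | A. A \<subseteq> {1..int n} \<and> sidon g A}"

definition lower_beta :: "nat \<Rightarrow> ereal" where
  "lower_beta g = liminf (\<lambda>n. ereal (real (beta g n) / sqrt (real n)))"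

definition upper_beta :: "nat \<Rightarrow> ereal" where
  "upper_beta g = limsup (\<lambda>n. ereal (real (beta g n) / sqrt (real n)))"

(* The autoconvolution is a nonnegative Lebesgue integral with values in [0, \<infinity>]: the
   Bochner integral would be 0 at points x where the integral diverges. *)
definition admissible :: "(real \<Rightarrow> real) \<Rightarrow> bool" where
  "admissible f \<longleftrightarrow>
     (\<forall>x. 0 \<le> f x) \<and> (\<forall>x. x \<notin> {0..1} \<longrightarrow> f x = 0) \<and> set_integrable lebesgue {0..1} f \<and>
     (\<forall>x. (\<integral>\<^sup>+t\<in>{0..1}. ennreal (f t * f (x - t)) \<partial>lebesgue) \<le> 1)"

definition sigma_const :: real where
  "sigma_const = Sup {(LINT t:{0..1}|lebesgue. f t) | f. admissible f}"

text \<open>The maximum and the supremum above are taken over sets for which they are meaningful.\<close>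

lemma beta_set_finite_nonempty:
  "finite {card A | A. A \<subseteq> {1..int n} \<and> sidon g A}"
  "{card A | A. A \<subseteq> {1..int n} \<and> sidon g A} \<noteq> {}"
proof -
  have "{card A | A. A \<subseteq> {1..int n} \<and> sidon g A} \<subseteq> card ` Pow {1..int n}" by auto
  then show "finite {card A | A. A \<subseteq> {1..int n} \<and> sidon g A}"
    by (rule finite_subset) simp
  have "sidon g {}" by (simp add: sidon_def rep_def rep_pairs_def)
  then show "{card A | A. A \<subseteq> {1..int n} \<and> sidon g A} \<noteq> {}" by blast
qed

lemma admissible_zero: "admissible (\<lambda>_. 0)"
  by (simp add: admissible_def set_integrable_def)

lemma admissible_integral_le:
  assumes "admissible f"
  shows "(LINT t:{0..1}|lebesgue. f t) \<le> sqrt 2"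
proof -
  have nn: "0 \<le> f x" and out: "x \<notin> {0..1} \<Longrightarrow> f x = 0"
    and int: "set_integrable lebesgue {0..1} f"
    and conv: "(\<integral>\<^sup>+t\<in>{0..1}. ennreal (f t * f (x - t)) \<partial>lebesgue) \<le> 1" for x
    using assms by (auto simp: admissible_def)
  have ind: "(\<lambda>t. indicator {0..1} t *\<^sub>R f t) = f"
    by (rule ext) (use out in \<open>auto simp: indicator_def\<close>)
  have fi: "integrable lebesgue f"
    using int unfolding set_integrable_def ind .
  then have "f \<in> borel_measurable lebesgue" by simp
  then have "f \<in> borel_measurable (completion lborel)" by simp
  from completion_ex_borel_measurable_real[OF this]
  obtain h0 where h0: "h0 \<in> borel_measurable lborel" "AE x in lborel. f x = h0 x" by auto
  define h where "h x = ennreal (h0 x)" for x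
  have hm [measurable]: "h \<in> borel_measurable borel"
    unfolding h_def using h0(1) by simp
  have AEh: "AE x in lborel. ennreal (f x) = h x"
    using h0(2) by eventually_elim (simp add: h_def)
  have AEr: "AE t in lborel. ennreal (f (x - t)) = h (x - t)" for x
  proof -
    have "distr lborel borel ((-) x) = lborel"
      using lborel_real_affine[of "-1" x] by (simp add: density_1)
    then have "AE t in distr lborel borel ((-) x). ennreal (f t) = h t"
      using AEh by (simp only:)
    then show ?thesis by (rule AE_distrD[rotated]) simp
  qed
  have inner: "(\<integral>\<^sup>+t. h t * h (x - t) \<partial>lborel) = (\<integral>\<^sup>+t\<in>{0..1}. ennreal (f t * f (x - t)) \<partial>lebesgue)" for x
  proof -
    have "(\<integral>\<^sup>+t. h t * h (x - t) \<partial>lborel) = (\<integral>\<^sup>+t. h t * h (x - t) \<partial>lebesgue)"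
      by (rule nn_integral_completion[symmetric])
    also have "\<dots> = (\<integral>\<^sup>+t\<in>{0..1}. ennreal (f t * f (x - t)) \<partial>lebesgue)"
    proof (rule nn_integral_cong_AE)
      have "AE t in lborel. h t * h (x - t) = ennreal (f t * f (x - t)) * indicator {0..1} t"
        using AEh AEr[of x]
      proof eventually_elim
        case (elim t)
        then show ?case
          using out[of t] by (auto simp: indicator_def ennreal_mult nn simp flip: elim)
      qed
      then show "AE t in lebesgue. h t * h (x - t) = ennreal (f t * f (x - t)) * indicator {0..1} t"
        by (rule AE_completion)
    qed
    finally show ?thesis .
  qed
  have bound: "(\<integral>\<^sup>+t. h t * h (x - t) \<partial>lborel) \<le> indicator {0..2} x" for x
  proof (cases "x \<in> {0..2}")
    case True
    then show ?thesis using conv[of x] inner[of x] by simp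
  next
    case False
    have "f t * f (x - t) = 0" for t
      using out[of t] out[of "x - t"] False by (cases "t \<in> {0..1}") auto
    then have "(\<integral>\<^sup>+t. h t * h (x - t) \<partial>lborel) = 0"
      unfolding inner by (simp only: ennreal_0 mult_zero_left nn_integral_const)
    then show ?thesis by simp
  qed
  have shift: "(\<integral>\<^sup>+x. h (x - t) \<partial>lborel) = (\<integral>\<^sup>+x. h x \<partial>lborel)" for t
    using nn_integral_real_affine[of h 1 "-t"] by simp
  have "(\<integral>\<^sup>+t. h t \<partial>lborel) * (\<integral>\<^sup>+t. h t \<partial>lborel)
      = (\<integral>\<^sup>+t. (\<integral>\<^sup>+x. h t * h (x - t) \<partial>lborel) \<partial>lborel)"
    by (simp add: nn_integral_cmult nn_integral_multc shift)
  also have "\<dots> = (\<integral>\<^sup>+x. (\<integral>\<^sup>+t. h t * h (x - t) \<partial>lborel) \<partial>lborel)"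
    by (rule lborel_pair.Fubini') simp
  also have "\<dots> \<le> (\<integral>\<^sup>+x. indicator {0..2::real} x \<partial>lborel)"
    by (rule nn_integral_mono) (rule bound)
  also have "\<dots> = 2" by simp
  finally have sq: "(\<integral>\<^sup>+t. h t \<partial>lborel) * (\<integral>\<^sup>+t. h t \<partial>lborel) \<le> 2" .
  have "(\<integral>\<^sup>+t. h t \<partial>lborel) = (\<integral>\<^sup>+t. h t \<partial>lebesgue)"
    by (rule nn_integral_completion[symmetric])
  also have "\<dots> = (\<integral>\<^sup>+t. ennreal (f t) \<partial>lebesgue)"
    by (rule nn_integral_cong_AE) (use AE_completion[OF AEh] in \<open>eventually_elim, simp\<close>)
  also have "\<dots> = ennreal (integral\<^sup>L lebesgue f)"
    by (rule nn_integral_eq_integral[OF fi]) (simp add: nn)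
  finally have eq: "(\<integral>\<^sup>+t. h t \<partial>lborel) = ennreal (integral\<^sup>L lebesgue f)" .
  have I0: "0 \<le> integral\<^sup>L lebesgue f" by (simp add: nn)
  have "ennreal (integral\<^sup>L lebesgue f * integral\<^sup>L lebesgue f) \<le> ennreal 2"
    using sq unfolding eq by (simp add: ennreal_mult I0)
  then have "(integral\<^sup>L lebesgue f)\<^sup>2 \<le> 2"
    by (subst (asm) ennreal_le_iff) (simp_all add: power2_eq_square)
  then have "integral\<^sup>L lebesgue f \<le> sqrt 2" by (rule real_le_rsqrt)
  then show ?thesis unfolding set_lebesgue_integral_def ind .
qed

lemma sigma_set_bdd_nonempty:
  "bdd_above {(LINT t:{0..1}|lebesgue. f t) | f. admissible f}"
  "{(LINT t:{0..1}|lebesgue. f t) | f. admissible f} \<noteq> {}"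
  using admissible_integral_le admissible_zero by (auto intro!: bdd_aboveI[of _ "sqrt 2"])

end

theory Submission
  imports Defs "HOL-Number_Theory.Number_Theory"
begin

text \<open>
  Upper bound: a \<open>g\<close>-Sidon set in \<open>{1..n}\<close> yields the admissible step function equal to
  \<open>sqrt (n / g)\<close> on the cells \<open>[(a - 1) / n, a / n)\<close>, so \<open>beta g n \<le> sigma_const * sqrt (g * n)\<close>.

  Lower bound: averaging an almost optimal \<open>f\<close> over windows gives integer weights \<open>\<phi> i\<close>,
  \<open>i < N\<close>, with \<open>\<phi> * \<phi> \<le> h\<close> and \<open>(\<Sum> \<phi> i)\<^sup>2 / (h N)\<close> close to \<open>sigma_const\<^sup>2\<close>.  The weight
  \<open>\<phi> i\<close> is realised by a union of about \<open>M\<^sup>2 \<phi> i\<close> parabolas \<open>{(u x, u x\<^sup>2)}\<close> modulo a prime \<open>p\<close>.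
  The sums of the parabolas with parameters \<open>u\<close> and \<open>v\<close> represent \<open>(a, b)\<close> exactly
  \<open>1 + \<chi> u * \<chi> v * \<chi> ((u + v) b - a\<^sup>2)\<close> times up to degenerate cases, \<open>\<chi>\<close> being the quadratic
  character.  The last factor depends only on \<open>u + v\<close>, so the
  character contributions nearly cancel as soon as \<open>\<chi> * \<chi>\<close> is small on the parameter set.  If
  this set is a two-dimensional grid \<open>{t + a d + b e}\<close>, a random choice of
  \<open>(t, d, e)\<close> achieves this: a non-degenerate additive quadruple is then uniformly distributed,
  and the second moment reduces to Jacobi sums.  Two auxiliary digits \<open>c < s\<close> absorb the carries
  when residues modulo \<open>p\<close> are turned into integers.

  Since \<open>s\<close> and \<open>M\<close> may vary with \<open>n\<close> and \<open>g\<close>, it suffices to have primes in every interval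
  \<open>(x / 32, x]\<close> with \<open>x\<close> large; no asymptotic formula for prime gaps is needed.
\<close>

section \<open>The upper bound\<close>

text \<open>With c = sqrt (n / g), the autoconvolution of \<open>f\<close> at any point is c^2 / n
  times an average of values of \<open>rep A\<close>, hence at most c^2 g / n = 1; this fixes the
  height of the steps. Each cell has length 1 / n, which gives the integral.\<close>

lemma sidon_step_function:
  assumes A: "A \<subseteq> {1..int n}" "sidon g A" and n: "n > 0" and g: "g > 0"
  defines "f \<equiv> \<lambda>x::real. sqrt (real n / real g) * indicator A (\<lfloor>real n * x\<rfloor> + 1)"
  shows "admissible f" "(LINT t:{0..1}|lebesgue. f t) = real (card A) / sqrt (real g * real n)"
proof -
  have fin: "finite A" using A(1) by (rule finite_subset) simp
  define c where "c = sqrt (real n / real g)"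
  have c0: "c > 0" using n g by (simp add: c_def)
  define J where "J a = {t::real. \<lfloor>real n * t\<rfloor> + 1 = a}" for a :: int
  have J: "J a = {(real_of_int a - 1) / real n ..< real_of_int a / real n}" for a
  proof -
    have *: "\<lfloor>y\<rfloor> + 1 = a \<longleftrightarrow> real_of_int a - 1 \<le> y \<and> y < real_of_int a" for y :: real by linarith
    show ?thesis unfolding J_def *
      using n by (simp add: set_eq_iff pos_divide_le_eq pos_less_divide_eq mult.commute)
  qed
  have Jm [measurable]: "J a \<in> sets borel" for a unfolding J by simp
  have Jl: "emeasure lborel (J a) = ennreal (1 / real n)" for a
    unfolding J using n by (simp add: field_simps)
  have f_sum: "f t = (\<Sum>a\<in>A. c * indicator (J a) t)" for t
  proof -
    have "(\<Sum>a\<in>A. c * indicator (J a) t) = (\<Sum>a\<in>A. if a = \<lfloor>real n * t\<rfloor> + 1 then c else 0)"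
      by (intro sum.cong) (auto simp: J_def indicator_def)
    then show ?thesis using fin by (simp add: f_def c_def indicator_def)
  qed
  have fm [measurable]: "f \<in> borel_measurable borel" unfolding f_sum[abs_def] by measurable
  have f0: "0 \<le> f x" for x by (simp add: f_def)
  have fout: "f x = 0" if "x \<notin> {0..<1}" for x
  proof -
    have "\<lfloor>real n * x\<rfloor> + 1 \<notin> {1..int n}"
    proof (cases "x < 0")
      case True
      then have "real n * x < 0" using n by (simp add: mult_pos_neg)
      then show ?thesis by simp
    next
      case False
      then have "real n * 1 \<le> real n * x" using that by (intro mult_left_mono) auto
      then have "int n \<le> \<lfloor>real n * x\<rfloor>" by (simp add: le_floor_iff)
      then show ?thesis by simp
    qed
    then show ?thesis using A(1) by (auto simp: f_def indicator_def)
  qed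
  have fout': "f x = 0" if "x \<notin> {0..1}" for x by (rule fout) (use that in auto)
  have integral: "(\<integral>\<^sup>+t. ennreal (f t) \<partial>lborel) = ennreal (c * card A / n)"
  proof -
    have "(\<integral>\<^sup>+t. ennreal (f t) \<partial>lborel) = (\<integral>\<^sup>+t. (\<Sum>a\<in>A. ennreal c * indicator (J a) t) \<partial>lborel)"
      unfolding f_sum using c0
      by (intro nn_integral_cong) (simp add: ennreal_mult ennreal_indicator flip: sum_ennreal)
    also have "\<dots> = (\<Sum>a\<in>A. ennreal c * ennreal (1 / real n))"
      by (simp add: nn_integral_sum nn_integral_cmult_indicator Jl)
    also have "\<dots> = ennreal (c * card A / n)"
      using c0 by (simp add: ennreal_of_nat_eq_real_of_nat flip: ennreal_mult)
    finally show ?thesis .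
  qed
  have int: "integrable lborel f"
    by (rule integrableI_nonneg) (simp_all add: f0 integral)
  have ind: "(\<lambda>t. indicator {0..1} t *\<^sub>R f t) = f"
    by (rule ext) (use fout' in \<open>auto simp: indicator_def\<close>)
  have "(\<integral>t. f t \<partial>lborel) = c * card A / n"
    using integral c0 f0 by (subst integral_eq_nn_integral) auto
  moreover have "(\<integral>t. f t \<partial>lebesgue) = (\<integral>t. f t \<partial>lborel)"
    by (rule integral_completion) simp
  moreover have "c * card A / n = real (card A) / sqrt (real g * real n)"
    unfolding c_def using n g by (simp add: real_sqrt_divide real_sqrt_mult field_simps)
  ultimately show "(LINT t:{0..1}|lebesgue. f t) = real (card A) / sqrt (real g * real n)"
    unfolding set_lebesgue_integral_def ind by simp
  have conv: "(\<integral>\<^sup>+t\<in>{0..1}. ennreal (f t * f (x - t)) \<partial>lebesgue) \<le> 1" for x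
  proof -
    (* Substituting t = (a - 1 + s) / n in the a-th interval turns the autoconvolution
       into an average of values of the representation function. *)
    have shift: "(\<integral>\<^sup>+t. indicator (J a) t * ennreal (f (x - t)) \<partial>lborel)
        = ennreal (1 / n) * (\<integral>\<^sup>+s. indicator {0..<1} s * ennreal (f (x - (real_of_int a - 1 + s) / n)) \<partial>lborel)" for a
    proof -
      have "(\<integral>\<^sup>+t. indicator (J a) t * ennreal (f (x - t)) \<partial>lborel) =
        ennreal \<bar>1 / n\<bar> * (\<integral>\<^sup>+s. indicator (J a) ((real_of_int a - 1) / n + 1 / n * s)
           * ennreal (f (x - ((real_of_int a - 1) / n + 1 / n * s))) \<partial>lborel)"
        using n by (intro nn_integral_real_affine) auto
      also have "\<dots> = ennreal (1 / n) * (\<integral>\<^sup>+s. indicator {0..<1} s * ennreal (f (x - (real_of_int a - 1 + s) / n)) \<partial>lborel)"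
      proof -
        have "indicator (J a) ((real_of_int a - 1) / n + 1 / n * s) = (indicator {0..<1} s :: ennreal)" for s
          unfolding J using n by (auto simp: indicator_def field_simps)
        moreover have "(real_of_int a - 1) / n + 1 / n * s = (real_of_int a - 1 + s) / n" for s
          by (simp add: add_divide_distrib)
        ultimately show ?thesis by simp
      qed
      finally show ?thesis .
    qed
    \<comment> \<open>After the substitution the index of the second factor is y - a with y = floor
      (n x - s) + 2 independent of a. For fixed s the sum over a therefore counts the
      representations of the single integer y.\<close>
    have val: "f (x - (real_of_int a - 1 + s) / n) = c * indicator A (\<lfloor>real n * x - s\<rfloor> + 2 - a)" for a s
    proof -
      have "real n * (x - (real_of_int a - 1 + s) / n) = (real n * x - s) - of_int (a - 1)"
        using n by (simp add: field_simps)
      then have "\<lfloor>real n * (x - (real_of_int a - 1 + s) / n)\<rfloor> = \<lfloor>real n * x - s\<rfloor> - (a - 1)"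
        by (simp only: floor_diff_of_int)
      then have *: "\<lfloor>real n * (x - (real_of_int a - 1 + s) / n)\<rfloor> + 1 = \<lfloor>real n * x - s\<rfloor> + 2 - a" by simp
      show ?thesis unfolding f_def c_def * ..
    qed
    have rep: "(\<Sum>a\<in>A. indicator A (y - a)) \<le> (of_nat g :: ennreal)" for y
    proof -
      have "(\<Sum>a\<in>A. indicator A (y - a)) = (of_nat (card {a\<in>A. y - a \<in> A}) :: ennreal)"
        using fin by (simp add: indicator_def sum.If_cases Int_def conj_commute)
      also have "card {a\<in>A. y - a \<in> A} = rep A y"
        unfolding rep_def rep_pairs_def
        by (rule bij_betw_same_card[where f = "\<lambda>a. (a, y - a)"]) (auto simp: bij_betw_def inj_on_def image_iff)
      also have "of_nat (rep A y) \<le> (of_nat g :: ennreal)" using A(2) by (simp add: sidon_def)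
      finally show ?thesis .
    qed
    have "(\<integral>\<^sup>+t\<in>{0..1}. ennreal (f t * f (x - t)) \<partial>lebesgue) = (\<integral>\<^sup>+t. ennreal (f t * f (x - t)) \<partial>lebesgue)"
      by (intro nn_integral_cong) (use fout' in \<open>auto simp: indicator_def\<close>)
    also have "\<dots> = (\<integral>\<^sup>+t. ennreal (f t * f (x - t)) \<partial>lborel)"
      by (rule nn_integral_completion)
    also have "\<dots> = (\<integral>\<^sup>+t. (\<Sum>a\<in>A. ennreal c * (indicator (J a) t * ennreal (f (x - t)))) \<partial>lborel)"
      using c0 by (intro nn_integral_cong)
        (simp add: f_sum[of t for t] sum_distrib_right f0 ennreal_mult ennreal_indicator sum_nonneg mult.assoc flip: sum_ennreal)
    also have "\<dots> = (\<Sum>a\<in>A. ennreal c * (\<integral>\<^sup>+t. indicator (J a) t * ennreal (f (x - t)) \<partial>lborel))"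
      by (simp add: nn_integral_sum nn_integral_cmult)
    also have "\<dots> = ennreal (c * (1 / n)) * (\<Sum>a\<in>A. (\<integral>\<^sup>+s. indicator {0..<1} s * (ennreal c * indicator A (\<lfloor>real n * x - s\<rfloor> + 2 - a)) \<partial>lborel))"
    proof -
      have "ennreal c * (ennreal (1 / n) * X) = ennreal (c * (1 / n)) * X" for X
        using c0 by (subst ennreal_mult) (auto simp: mult.assoc)
      then show ?thesis unfolding shift val sum_distrib_left
        using c0 by (simp only: ennreal_mult ennreal_indicator less_imp_le indicator_pos_le)
    qed
    also have "\<dots> = ennreal (c * (1 / n)) * (\<integral>\<^sup>+s. indicator {0..<1} s * (ennreal c * (\<Sum>a\<in>A. indicator A (\<lfloor>real n * x - s\<rfloor> + 2 - a))) \<partial>lborel)"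
      by (simp add: sum_distrib_left nn_integral_sum)
    also have "\<dots> \<le> ennreal (c * (1 / n)) * (\<integral>\<^sup>+s. indicator {0..<1::real} s * (ennreal c * of_nat g) \<partial>lborel)"
      by (intro mult_left_mono nn_integral_mono rep) auto
    also have "\<dots> = ennreal (c * (1 / n)) * (ennreal c * of_nat g)"
      by (simp add: nn_integral_multc)
    also have "\<dots> = ennreal (c * c * g / n)"
      using c0 by (simp add: ennreal_of_nat_eq_real_of_nat mult.assoc flip: ennreal_mult)
    also have "c * c * g / n = 1" using n g by (simp add: c_def field_simps)
    finally show ?thesis by simp
  qed
  have "integrable lebesgue f" by (rule integrable_completion[THEN iffD2]) (simp_all add: int)
  then show "admissible f"
    unfolding admissible_def set_integrable_def ind using f0 fout' conv by auto
qed

lemma beta_attained: "\<exists>A. A \<subseteq> {1..int n} \<and> sidon g A \<and> card A = beta g n"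
  using Max_in[OF beta_set_finite_nonempty[of n g]] unfolding beta_def by auto

lemma beta_ge: "A \<subseteq> {1..int n} \<Longrightarrow> sidon g A \<Longrightarrow> card A \<le> beta g n"
  unfolding beta_def by (rule Max_ge[OF beta_set_finite_nonempty(1)]) blast

lemma beta_le_sigma:
  assumes "n > 0" "g > 0"
  shows "real (beta g n) \<le> sigma_const * sqrt (real g * real n)"
proof -
  obtain A where A: "A \<subseteq> {1..int n}" "sidon g A" "card A = beta g n"
    using beta_attained by blast
  have "real (beta g n) / sqrt (real g * real n) \<le> sigma_const"
    unfolding sigma_const_def
    unfolding A(3)[symmetric]
    using sidon_step_function(1)[OF A(1,2) assms] sidon_step_function(2)[OF A(1,2) assms, symmetric]
    by (intro cSup_upper sigma_set_bdd_nonempty(1) CollectI exI conjI)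
  then show ?thesis using assms by (simp add: field_simps)
qed

lemma upper_beta_le:
  assumes "g > 0"
  shows "upper_beta g \<le> ereal (sigma_const * sqrt (real g))"
  unfolding upper_beta_def
proof (rule Limsup_bounded)
  show "\<forall>\<^sub>F n in sequentially. ereal (real (beta g n) / sqrt (real n)) \<le> ereal (sigma_const * sqrt (real g))"
    using eventually_gt_at_top[of 0]
  proof eventually_elim
    case (elim n)
    then show ?case using beta_le_sigma[OF elim assms]
      by (simp add: real_sqrt_mult field_simps)
  qed
qed

section \<open>Primes between x/32 and x\<close>

lemma central_binomial_ge: "2 ^ n \<le> (2 * n) choose n"
proof (induction n)
  case (Suc n)
  have "Suc n * (2 * Suc n choose Suc n) = 2 * Suc n * (Suc (2 * n) choose n)"
    using Suc_times_binomial_eq[of "Suc (2*n)" n] by simp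
  then have "(2 * Suc n choose Suc n) = 2 * (Suc (2 * n) choose n)"
    by (metis mult.assoc mult.commute mult_cancel1 Zero_not_Suc)
  moreover have "(2 * n choose n) \<le> (Suc (2 * n) choose n)"
    by (rule binomial_right_mono) simp
  ultimately show ?case using Suc by simp
qed simp

lemma prod_primes_dvd:
  fixes n :: nat
  assumes "finite A" "\<And>p. p \<in> A \<Longrightarrow> prime p \<and> p dvd n"
  shows "\<Prod>A dvd n"
  using assms
proof (induction A rule: finite_induct)
  case (insert p A)
  have "coprime p (\<Prod>A)"
    using insert by (intro prod_coprime_right) (auto intro: primes_coprime)
  then show ?case using insert by (simp add: divides_mult)
qed simp

text \<open>The primes in (2^j, 2^(j+1)] all divide the central binomial coefficient of 2^(j+1),
  which is at most 4^(2^j). This extra factor just squares the bound for j, giving the bound for j +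
  1.\<close>

lemma primorial_pow2_le: "\<Prod>{p::nat. prime p \<and> p \<le> 2 ^ j} \<le> 4 ^ 2 ^ j"
proof (induction j)
  case 0
  have "{p::nat. prime p \<and> p \<le> 2 ^ 0} = {}" by (auto dest: prime_gt_1_nat)
  then show ?case by (simp only: prod.empty) simp
next
  case (Suc j)
  let ?n = "2 ^ j :: nat"
  let ?Q = "{p::nat. prime p \<and> ?n < p \<and> p \<le> 2 * ?n}"
  have "\<Prod>?Q dvd (2 * ?n choose ?n)"
  proof (rule prod_primes_dvd)
    show "finite ?Q" by simp
    fix p assume "p \<in> ?Q"
    then have p: "prime p" "?n < p" "p \<le> 2 * ?n" by auto
    have "p dvd fact (2 * ?n)" using p by (simp add: prime_dvd_fact_iff)
    then have "p dvd fact ?n * fact ?n * (2 * ?n choose ?n)"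
      using binomial_fact_lemma[of ?n "2 * ?n"] by simp
    moreover have "\<not> p dvd fact ?n" using p by (simp add: prime_dvd_fact_iff)
    ultimately show "prime p \<and> p dvd (2 * ?n choose ?n)"
      using p(1) by (simp add: prime_dvd_mult_iff)
  qed
  then have "\<Prod>?Q \<le> (2 * ?n choose ?n)" by (rule dvd_imp_le) simp
  also have "\<dots> \<le> 2 ^ (2 * ?n)" by (rule binomial_le_pow2)
  finally have 1: "\<Prod>?Q \<le> 4 ^ ?n" by (simp add: power_mult)
  have "{p::nat. prime p \<and> p \<le> 2 ^ Suc j} = {p. prime p \<and> p \<le> ?n} \<union> ?Q" by auto
  then have "\<Prod>{p::nat. prime p \<and> p \<le> 2 ^ Suc j} = \<Prod>{p. prime p \<and> p \<le> ?n} * \<Prod>?Q"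
    by (simp add: prod.union_disjoint[symmetric] Int_def)
  also have "\<dots> \<le> 4 ^ ?n * 4 ^ ?n" by (intro mult_mono Suc 1) auto
  also have "\<dots> = 4 ^ 2 ^ Suc j" by (simp add: power_add[symmetric] mult_2)
  finally show ?case .
qed

text \<open>Applied to the least common multiple of 1, ..., n, this bounds it from below by a
  binomial coefficient. The numbers 1 / (m C(n, m)) form the harmonic triangle: each entry is a
  difference of two entries with smaller m, and for m = 1 they are the reciprocals 1 / n, which
  \<open>D\<close> turns into integers.\<close>

lemma times_binomial_dvd:
  fixes D :: nat
  assumes "\<And>k. 1 \<le> k \<Longrightarrow> k \<le> n \<Longrightarrow> k dvd D" "1 \<le> m" "m \<le> n"
  shows "m * (n choose m) dvd D"
proof -
  (* Recurrence in Leibniz's harmonic triangle. *)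
  have "real D / (real m * real (n choose m)) \<in> \<int>"
    using assms(2,3,1)
  proof (induction m arbitrary: n rule: dec_induct)
    case base
    then have "n dvd D" by auto
    then obtain c where "D = n * c" by auto
    with base show ?case by simp
  next
    case (step m)
    have n: "n > 0" "m > 0" "m < n" using step by auto
    obtain k where k: "n = Suc k" using n by (cases n) auto
    have e1: "real (Suc m) * real (Suc k choose Suc m) = real (Suc k) * real (k choose m)"
      using Suc_times_binomial_eq[of k m] by (metis of_nat_mult mult.commute)
    have e2: "real (Suc k - m) * real (Suc k choose m) = real (Suc k) * real (k choose m)"
      using binomial_absorb_comp[of "Suc k" m] by (metis of_nat_mult diff_Suc_1)
    have e3: "(k choose m) > 0" using k n by simp
    have e4: "real (Suc k choose m) = real (Suc k) * real (k choose m) / real (Suc k - m)"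
      using e2 k n by (simp add: field_simps)
    have "1 / (real (Suc m) * real (n choose Suc m))
        = 1 / (real m * real ((n - 1) choose m)) - 1 / (real m * real (n choose m))"
    proof -
      have *: "1 / (s * c) = 1 / (t * c) - 1 / (t * (s * c / (s - t)))"
        if "s \<noteq> 0" "t \<noteq> 0" "c \<noteq> 0" "s - t \<noteq> 0" for s t c :: real
      proof -
        have "1 / (t * (s * c / (s - t))) = (s - t) / (s * t * c)" using that by simp
        moreover have "1 / (t * c) = s / (s * t * c)" "1 / (s * c) = t / (s * t * c)" using that by simp_all
        ultimately show ?thesis by (simp only: diff_divide_distrib[symmetric]) simp
      qed
      have "real (Suc k - m) = real (Suc k) - real m"
        using n k by (simp add: of_nat_diff)
      then show ?thesis unfolding k e1 e4 diff_Suc_1 using *[of "real (Suc k)" "real m" "real (k choose m)"] n k e3 by simp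
    qed
    then have "real D / (real (Suc m) * real (n choose Suc m))
        = real D / (real m * real ((n - 1) choose m)) - real D / (real m * real (n choose m))"
      by (metis mult.right_neutral right_diff_distrib times_divide_eq_right)
    moreover have "real D / (real m * real ((n - 1) choose m)) \<in> \<int>"
      using step n by (intro step.IH) auto
    moreover have "real D / (real m * real (n choose m)) \<in> \<int>"
      using step n by (intro step.IH) auto
    ultimately show ?case by (metis Ints_diff)
  qed
  then obtain z where z: "real D / (real m * real (n choose m)) = of_int z" by (auto elim: Ints_cases)
  have pos: "m * (n choose m) > 0" using assms by simp
  have "real D = real_of_int z * real (m * (n choose m))"
    using z pos by (simp add: field_simps)
  then have "real_of_int (int D) = real_of_int (z * int (m * (n choose m)))" by simp
  then have "int D = z * int (m * (n choose m))" by (simp only: of_int_eq_iff)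
  then have "int (m * (n choose m)) dvd int D" by simp
  then show ?thesis by (simp only: of_nat_dvd_iff)
qed

text \<open>Chebyshev's method with N = 4^i. The central binomial coefficient forces the least
  common multiple of 1, ..., N to be at least 2^(N/2). If (N/8, N] contained no prime, the primes up
  to sqrt N = 2^i would contribute at most N^(2^i), and the larger ones, occurring to the first
  power and bounded by N/8, at most 4^(N/8). Comparing exponents leaves 2^i \<le> 8 i.\<close>

lemma prime_between_pow4:
  assumes i: "6 \<le> i"
  shows "\<exists>p::nat. prime p \<and> 4 ^ i < 8 * p \<and> p \<le> 4 ^ i"
proof (rule ccontr)
  assume no: "\<not> ?thesis"
  define N where "N = (4::nat) ^ i"
  define e where "e p = (GREATEST k. p ^ k \<le> N)" for p :: nat
  \<comment> \<open>With these exponents \<open>D\<close> is the least common multiple of 1, ...,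
    \<open>N\<close>.\<close>
  define D where "D = (\<Prod>p | prime p \<and> p \<le> N. p ^ e p)"
  have N0: "N > 0" by (simp add: N_def)
  have bd: "k \<le> N" if "p ^ k \<le> N" "prime p" for p k
  proof -
    have "k < 2 ^ k" by (rule less_exp)
    also have "\<dots> \<le> p ^ k" using that(2) by (intro power_mono prime_ge_2_nat) auto
    finally show ?thesis using that by simp
  qed
  have e_le: "p ^ e p \<le> N" and e_ge: "p ^ k \<le> N \<Longrightarrow> k \<le> e p" if "prime p" for p k
  proof -
    show "p ^ e p \<le> N" unfolding e_def
      by (rule GreatestI_nat[of _ 0 N]) (use bd that N0 in auto)
    show "k \<le> e p" if "p ^ k \<le> N" unfolding e_def
      by (rule Greatest_le_nat[of _ _ N]) (use bd that \<open>prime p\<close> in auto)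
  qed
  have dvdD: "k dvd D" if k: "1 \<le> k" "k \<le> N" for k
  proof -
    have "k = (\<Prod>p\<in>prime_factors k. p ^ multiplicity p k)"
      using k by (intro prime_factorization_nat) auto
    also have "\<dots> dvd D" unfolding D_def
    proof (rule prod_dvd_prod_subset2)
      show "prime_factors k \<subseteq> {p. prime p \<and> p \<le> N}"
        using k by (auto dest!: dvd_imp_le)
      fix p assume p: "p \<in> prime_factors k"
      have "p ^ multiplicity p k \<le> k"
        using k by (intro dvd_imp_le multiplicity_dvd) auto
      then show "p ^ multiplicity p k dvd p ^ e p"
        using p k by (intro le_imp_power_dvd e_ge) auto
    qed auto
    finally show ?thesis .
  qed
  have Ne: "2 * (N div 2) = N" unfolding N_def using i by (cases i) auto
  have D0: "D > 0" unfolding D_def by (intro prod_pos) (auto dest: prime_gt_0_nat)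
  have "2 ^ (N div 2) \<le> (2 * (N div 2)) choose (N div 2)" by (rule central_binomial_ge)
  also have "\<dots> = N choose (N div 2)" using Ne by simp
  also have "\<dots> \<le> (N div 2) * (N choose (N div 2))" using N0 Ne by (cases "N div 2") auto
  also have "\<dots> \<le> D"
  proof (rule dvd_imp_le[OF _ D0], rule times_binomial_dvd)
    show "1 \<le> N div 2" "N div 2 \<le> N" using N0 Ne by linarith+
    show "k dvd D" if "1 \<le> k" "k \<le> N" for k using dvdD[OF that] .
  qed
  finally have low: "2 ^ (N div 2) \<le> D" .
  define A where "A = {p::nat. prime p \<and> p \<le> 2 ^ i}"
  define B where "B = {p::nat. prime p \<and> 2 ^ i < p \<and> p \<le> 2 ^ (2 * i - 3)}"
  have N2: "N = 8 * 2 ^ (2 * i - 3)"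
  proof -
    have "(8::nat) * 2 ^ (2 * i - 3) = 2 ^ (3 + (2 * i - 3))" by (simp add: power_add)
    also have "\<dots> = N" using i by (simp add: N_def power_mult)
    finally show ?thesis by simp
  qed
  have sq: "N = 2 ^ i * 2 ^ i" by (simp add: N_def flip: power_mult_distrib)
  have "{p. prime p \<and> p \<le> N} = A \<union> B"
  proof -
    have 1: "p \<le> 2 ^ (2 * i - 3)" if "prime p" "p \<le> N" for p
    proof -
      have "\<not> N < 8 * p" using no that unfolding N_def by blast
      then show ?thesis using N2 by linarith
    qed
    have 2: "2 ^ i \<le> N" unfolding sq by simp
    have 3: "2 ^ (2 * i - 3) \<le> N" unfolding N2 by simp
    show ?thesis unfolding A_def B_def using 1 2 3 by (auto intro: order_trans)
  qed
  then have "D = (\<Prod>p\<in>A. p ^ e p) * (\<Prod>p\<in>B. p ^ e p)"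
    unfolding D_def by (simp add: A_def B_def prod.union_disjoint[symmetric] Int_def)
  also have "\<dots> \<le> N ^ 2 ^ i * 4 ^ 2 ^ (2 * i - 3)"
  proof (rule mult_mono)
    have "(\<Prod>p\<in>A. p ^ e p) \<le> (\<Prod>p\<in>A. N)" by (intro prod_mono) (auto simp: A_def e_le)
    also have "\<dots> = N ^ card A" by simp
    also have "A \<subseteq> {1..2 ^ i}" by (auto simp: A_def prime_ge_1_nat[simplified])
    then have "card A \<le> 2 ^ i" using card_mono[of "{1..2^i}" A] by simp
    then have "N ^ card A \<le> N ^ 2 ^ i" using N0 by (intro power_increasing) auto
    finally show "(\<Prod>p\<in>A. p ^ e p) \<le> N ^ 2 ^ i" .
    have "e p \<le> 1" if "p \<in> B" for p
    proof (rule ccontr)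
      assume "\<not> e p \<le> 1"
      have "N < p * p" unfolding sq using that by (intro mult_strict_mono) (auto simp: B_def)
      also have "\<dots> = p ^ 2" by (simp add: power2_eq_square)
      also have "\<dots> \<le> p ^ e p" using \<open>\<not> e p \<le> 1\<close> that
        by (intro power_increasing) (auto simp: B_def prime_ge_1_nat)
      also have "\<dots> \<le> N" using that by (intro e_le) (auto simp: B_def)
      finally show False by simp
    qed
    then have "p ^ e p \<le> p ^ 1" if "p \<in> B" for p
      using that prime_ge_1_nat[of p] by (intro power_increasing) (auto simp: B_def)
    then have "(\<Prod>p\<in>B. p ^ e p) \<le> (\<Prod>p\<in>B. p ^ 1)"
      by (intro prod_mono) auto
    also have "\<dots> \<le> \<Prod>{p. prime p \<and> p \<le> 2 ^ (2 * i - 3)}"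
      unfolding power_one_right
      by (intro dvd_imp_le prod_dvd_prod_subset prod_pos) (auto simp: B_def dest: prime_gt_0_nat)
    also have "\<dots> \<le> 4 ^ 2 ^ (2 * i - 3)" by (rule primorial_pow2_le)
    finally show "(\<Prod>p\<in>B. p ^ e p) \<le> 4 ^ 2 ^ (2 * i - 3)" .
  qed auto
  also have "\<dots> = 2 ^ (2 * i * 2 ^ i + 2 * 2 ^ (2 * i - 3))"
  proof -
    have "N ^ 2 ^ i = 2 ^ (2 * i * 2 ^ i)"
      by (simp add: N_def power_mult[of 2 2 i, symmetric] flip: power_mult) (simp add: power_mult)
    moreover have "(4::nat) ^ 2 ^ (2 * i - 3) = 2 ^ (2 * 2 ^ (2 * i - 3))" by (simp add: power_mult)
    ultimately show ?thesis by (simp add: power_add)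
  qed
  finally have "(2::nat) ^ (N div 2) \<le> 2 ^ (2 * i * 2 ^ i + 2 * 2 ^ (2 * i - 3))"
    using low by linarith
  then have "N div 2 \<le> 2 * i * 2 ^ i + 2 * 2 ^ (2 * i - 3)" by (simp only: power_increasing_iff one_less_numeral_iff semiring_norm)
  then have "4 * 2 ^ (2 * i - 3) \<le> 2 * (i * 2 ^ i) + 2 * 2 ^ (2 * i - 3)" using N2 by (simp add: mult.assoc)
  then have "N \<le> 8 * (i * 2 ^ i)" using N2 by linarith
  then have "2 ^ i \<le> 8 * i" using sq by simp
  \<comment> \<open>The induction starts from 48 < 64, which is why i is at least 6.\<close>
  moreover have "8 * i < 2 ^ i" using i by (induction i rule: dec_induct) auto
  ultimately show False by simp
qed

text \<open>The constant is 4 * 8: rounding x down to a power of 4 loses a factor below 4, and the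
  prime found below that power loses a factor below 8.\<close>

lemma prime_within_factor_32:
  fixes x :: real
  assumes "4 ^ 6 \<le> x"
  shows "\<exists>p::nat. prime p \<and> x < 32 * real p \<and> real p \<le> x"
proof -
  define i where "i = nat \<lfloor>log 4 x\<rfloor>"
  have x: "x > 0" using assms by simp
  have l6: "6 \<le> log 4 x" using assms x by (simp add: le_log_iff powr_realpow[symmetric])
  then have i: "real i = of_int \<lfloor>log 4 x\<rfloor>" by (simp add: i_def)
  have i6: "6 \<le> i" using l6 by (simp add: i_def le_nat_iff le_floor_iff)
  have "real i \<le> log 4 x" unfolding i by simp
  then have 1: "4 ^ i \<le> x" using x by (simp add: le_log_iff powr_realpow)
  have "log 4 x < real i + 1" unfolding i by linarith
  then have "x < 4 powr (real i + 1)" using x by (simp add: log_less_iff)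
  then have 2: "x < 4 * 4 ^ i" by (simp add: powr_add powr_realpow)
  from prime_between_pow4[OF i6] obtain p :: nat where p: "prime p" "4 ^ i < 8 * p" "p \<le> 4 ^ i" by auto
  have "real (4 ^ i) < real (8 * p)" "real p \<le> 4 ^ i" using p by (simp_all only: of_nat_less_iff of_nat_le_iff of_nat_le_numeral_power_cancel_iff)
  then have "x < 32 * real p" using 2 by simp
  moreover have "real p \<le> x" using \<open>real p \<le> 4 ^ i\<close> 1 by (rule order_trans)
  ultimately show ?thesis using p(1) by blast
qed

section \<open>Quadratic characters and parabolas\<close>

locale odd_prime =
  fixes p :: nat
  assumes prime_p: "prime p" and gt2: "2 < p"
begin

abbreviation chi :: "int \<Rightarrow> int" where "chi a \<equiv> Legendre a (int p)"

abbreviation R :: "int set" where "R \<equiv> {0..<int p}"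

lemma prime_int: "prime (int p)" using prime_p by simp

lemma mod_in_R: "x mod int p \<in> R" using gt2 by simp

lemma dvd_small: "int p dvd x \<Longrightarrow> \<bar>x\<bar> < int p \<Longrightarrow> x = 0"
  using dvd_imp_le_int[of x "int p"] by force

lemma chi_cong: "[a = b] (mod int p) \<Longrightarrow> chi a = chi b"
  by (auto simp: Legendre_def QuadRes_def cong_def)

lemma chi_mod [simp]: "chi (a mod int p) = chi a"
  by (rule chi_cong) (simp add: cong_def)

lemma chi_cases: "chi a = 0 \<or> chi a = 1 \<or> chi a = -1"
  by (simp add: Legendre_def)

lemma chi_abs_le: "\<bar>chi a\<bar> \<le> 1"
  by (simp add: Legendre_def)

lemma chi_0: "int p dvd a \<Longrightarrow> chi a = 0"
  by (simp add: Legendre_def cong_0_iff)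

lemma chi_square: "\<not> int p dvd a \<Longrightarrow> chi a * chi a = 1"
  by (simp add: Legendre_def cong_0_iff)

text \<open>Euler's criterion gives the identity modulo p. Both sides lie in {-1, 0, 1}, so they
  differ by at most 2 < p and must agree.\<close>

lemma chi_mult: "chi (a * b) = chi a * chi b"
proof -
  let ?k = "(p - 1) div 2"
  have "[chi (a * b) = (a * b) ^ ?k] (mod int p)"
    using euler_criterion[OF prime_p gt2] by simp
  moreover have "[chi a * chi b = a ^ ?k * b ^ ?k] (mod int p)"
    using euler_criterion[OF prime_p gt2] by (intro cong_mult)
  ultimately have "[chi (a * b) = chi a * chi b] (mod int p)"
    by (metis power_mult_distrib cong_trans cong_sym)
  then have d: "int p dvd chi (a * b) - chi a * chi b" by (simp add: cong_iff_dvd_diff)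
  have "\<bar>chi (a * b) - chi a * chi b\<bar> \<le> 2"
    using chi_cases[of "a * b"] chi_cases[of a] chi_cases[of b] by auto
  then have "\<bar>chi (a * b) - chi a * chi b\<bar> < int p" using gt2 by linarith
  then have "chi (a * b) - chi a * chi b = 0" using d by (intro dvd_small)
  then show ?thesis by simp
qed

lemma card_sqrt: "int (card {x \<in> R. [x\<^sup>2 = D] (mod int p)}) = 1 + chi D"
proof -
  let ?S = "{x \<in> R. [x\<^sup>2 = D] (mod int p)}"
  consider (zero) "int p dvd D" | (res) y where "\<not> int p dvd D" "[y\<^sup>2 = D] (mod int p)"
    | (non) "\<not> int p dvd D" "\<not> QuadRes (int p) D"
    by (auto simp: QuadRes_def)
  then show ?thesis
  proof cases
    case zero
    have "?S = {0}"
    proof -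
      have "x = 0" if "x \<in> R" "[x\<^sup>2 = D] (mod int p)" for x
      proof -
        have "int p dvd x\<^sup>2" using that(2) zero by (metis cong_dvd_iff)
        then have "int p dvd x" using prime_int by (metis prime_dvd_power)
        then show ?thesis using that(1) by (auto dest: zdvd_imp_le)
      qed
      moreover have "[0\<^sup>2 = D] (mod int p)" using zero by (simp add: cong_def mod_eq_0_iff_dvd)
      ultimately show ?thesis using gt2 by auto
    qed
    then show ?thesis using zero by (simp add: chi_0)
  next
    case res
    have y: "\<not> int p dvd y" using res by (metis cong_dvd_iff dvd_power zero_less_numeral dvd_trans)
    have "?S = {y mod int p, (- y) mod int p}"
    proof (intro equalityI subsetI)
      fix x assume "x \<in> ?S"
      then have x: "x \<in> R" "[x\<^sup>2 = D] (mod int p)" by auto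
      then have "[x\<^sup>2 = y\<^sup>2] (mod int p)" using res(2) by (metis cong_trans cong_sym)
      then have "int p dvd (x - y) * (x + y)"
        by (simp add: cong_iff_dvd_diff power2_eq_square algebra_simps)
      then have "int p dvd x - y \<or> int p dvd x - (- y)"
        using prime_int by (simp add: prime_dvd_mult_iff)
      then have "x mod int p = y mod int p \<or> x mod int p = (- y) mod int p"
        by (simp only: mod_eq_dvd_iff)
      then show "x \<in> {y mod int p, (- y) mod int p}" using x(1) by auto
    next
      fix x assume "x \<in> {y mod int p, (- y) mod int p}"
      then consider "x = y mod int p" | "x = (- y) mod int p" by auto
      then have "[x\<^sup>2 = y\<^sup>2] (mod int p)"
      proof cases
        case 1
        then show ?thesis by (intro cong_pow) (simp add: cong_def)
      next
        case 2
        then have "[x\<^sup>2 = (- y)\<^sup>2] (mod int p)" by (intro cong_pow) (simp add: cong_def)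
        then show ?thesis by simp
      qed
      then have "[x\<^sup>2 = D] (mod int p)" using res(2) by (rule cong_trans)
      then show "x \<in> ?S" using \<open>x \<in> _\<close> mod_in_R by auto
    qed
    moreover have "y mod int p \<noteq> (- y) mod int p"
    proof
      assume "y mod int p = (- y) mod int p"
      then have "int p dvd 2 * y" by (simp add: mod_eq_dvd_iff)
      then have "int p dvd 2" using prime_int y by (simp add: prime_dvd_mult_iff)
      then show False using gt2 by (auto dest: zdvd_imp_le)
    qed
    moreover have "chi D = 1" using res by (auto simp: Legendre_def QuadRes_def cong_0_iff)
    ultimately show ?thesis by simp
  next
    case non
    then have S: "?S = {}" by (auto simp: QuadRes_def)
    have "chi D = -1" using non by (simp add: Legendre_def cong_0_iff)
    then show ?thesis unfolding S by simp
  qed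
qed

lemma sum_affine:
  fixes f :: "int \<Rightarrow> int"
  assumes "\<not> int p dvd c" "\<And>x. f (x mod int p) = f x"
  shows "(\<Sum>x\<in>R. f (c * x + e)) = (\<Sum>x\<in>R. f x)"
proof -
  let ?h = "\<lambda>x. (c * x + e) mod int p"
  have "inj_on ?h R"
  proof (rule inj_onI)
    fix x y assume xy: "x \<in> R" "y \<in> R" "?h x = ?h y"
    then have "int p dvd c * (x - y)" by (simp add: mod_eq_dvd_iff algebra_simps)
    then have "int p dvd x - y" using prime_int assms(1) by (simp add: prime_dvd_mult_iff)
    then have "x mod int p = y mod int p" by (simp add: mod_eq_dvd_iff)
    then show "x = y" using xy by simp
  qed
  moreover have "?h ` R \<subseteq> R" using mod_in_R by blast
  ultimately have "bij_betw ?h R R"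
    unfolding bij_betw_def by (intro conjI endo_inj_surj) auto
  then have "(\<Sum>x\<in>R. f (?h x)) = (\<Sum>x\<in>R. f x)" by (rule sum.reindex_bij_betw)
  then show ?thesis by (simp only: assms(2))
qed

text \<open>Every x in \<open>R\<close> has exactly one square modulo p, so the numbers 1 +
  \<open>chi D\<close> of square roots add up to p.\<close>

lemma sum_chi: "(\<Sum>x\<in>R. chi x) = 0"
proof -
  have "(\<Sum>D\<in>R. int (card {x \<in> R. [x\<^sup>2 = D] (mod int p)}))
      = (\<Sum>D\<in>R. int (card {x \<in> R. x\<^sup>2 mod int p = D}))"
    by (intro sum.cong refl) (simp add: cong_def)
  also have "\<dots> = (\<Sum>x\<in>R. 1)"
  proof -
    have "(\<lambda>x. x\<^sup>2 mod int p) ` R \<subseteq> R" using mod_in_R by blast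
    then show ?thesis using sum.group[of R R "\<lambda>x. x\<^sup>2 mod int p" "\<lambda>_. 1 :: int"] by simp
  qed
  finally have "(\<Sum>D\<in>R. 1 + chi D) = (\<Sum>x\<in>R. 1)" unfolding card_sqrt .
  then show ?thesis by (simp add: sum.distrib)
qed

section \<open>Jacobi sums of the quadratic character\<close>

definition J :: "int \<Rightarrow> int" where "J w = (\<Sum>x\<in>R. chi x * chi (w - x))"

lemma not_dvd_1: "\<not> int p dvd 1" using gt2 by (auto dest: zdvd_imp_le)

lemma chi_mod_diff [simp]: "chi (a - b mod int p) = chi (a - b)"
  "chi (b mod int p - a) = chi (b - a)"
  by (rule chi_cong, simp add: cong_def mod_simps)+

text \<open>Replacing x by c x pulls out the factor \<open>chi c * chi c\<close>, which is
  1.\<close>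

lemma J_scale:
  assumes "\<not> int p dvd c"
  shows "J (c * w) = J w"
proof -
  have "J (c * w) = (\<Sum>x\<in>R. chi (c * x + 0) * chi (c * w - (c * x + 0)))"
    unfolding J_def by (rule sum_affine[symmetric]) (use assms in simp_all)
  also have "\<dots> = (\<Sum>x\<in>R. (chi c * chi c) * (chi x * chi (w - x)))"
  proof (intro sum.cong refl)
    fix x
    have "c * w - (c * x + 0) = c * (w - x)" by (simp add: algebra_simps)
    then show "chi (c * x + 0) * chi (c * w - (c * x + 0)) = (chi c * chi c) * (chi x * chi (w - x))"
      by (simp add: chi_mult)
  qed
  finally show ?thesis by (simp only: chi_square[OF assms] J_def mult_1)
qed

lemma sum_J: "(\<Sum>w\<in>R. J w) = 0"
proof -
  have *: "(\<Sum>w\<in>R. chi (w - x)) = 0" for x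
    using sum_affine[of 1 chi "- x"] not_dvd_1 sum_chi by simp
  have "(\<Sum>w\<in>R. J w) = (\<Sum>x\<in>R. chi x * (\<Sum>w\<in>R. chi (w - x)))"
    unfolding J_def sum_distrib_left by (rule sum.swap)
  then show ?thesis by (simp only: * mult_zero_right sum.neutral_const)
qed

lemma J_0_abs: "\<bar>J 0\<bar> \<le> int p - 1"
proof -
  have "J 0 = (\<Sum>x\<in>R - {0}. chi x * chi (0 - x))"
    unfolding J_def by (rule sum.mono_neutral_right) (auto simp: chi_0)
  also have "\<bar>\<dots>\<bar> \<le> (\<Sum>x\<in>R - {0}. \<bar>chi x * chi (0 - x)\<bar>)" by (rule sum_abs)
  also have "\<dots> \<le> (\<Sum>x\<in>R - {0}. 1)"
    by (intro sum_mono) (simp only: chi_mult[symmetric] chi_abs_le)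
  also have "\<dots> = int p - 1" using gt2 by simp
  finally show ?thesis .
qed

text \<open>No exact evaluation is needed. By scaling, \<open>J\<close> is constant off 0, and its
  total is 0, so J 0 = -(p - 1) J 1. The trivial bound |J 0| \<le> p - 1 then yields |J 1| \<le> 1,
  and the sum is at most (p - 1)^2 + (p - 1).\<close>

lemma sum_J_square: "(\<Sum>w\<in>R. (J w)\<^sup>2) \<le> (int p)\<^sup>2"
proof -
  have J1: "J w = J 1" if "w \<in> R - {0}" for w
    using J_scale[of w 1] that dvd_small[of w] by auto
  have split: "(\<Sum>w\<in>R. f (J w)) = f (J 0) + (int p - 1) * f (J 1)" for f :: "int \<Rightarrow> int"
  proof -
    have "(\<Sum>w\<in>R. f (J w)) = f (J 0) + (\<Sum>w\<in>R - {0}. f (J w))"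
      using gt2 by (intro sum.remove) auto
    also have "(\<Sum>w\<in>R - {0}. f (J w)) = (\<Sum>w\<in>R - {0}. f (J 1))"
      by (intro sum.cong refl arg_cong[where f = f] J1)
    finally show ?thesis using gt2 by simp
  qed
  have "J 0 + (int p - 1) * J 1 = 0" using split[of id] sum_J by simp
  then have "J 0 = - ((int p - 1) * J 1)" by simp
  then have "(int p - 1) * \<bar>J 1\<bar> = \<bar>J 0\<bar>" using gt2 by (simp add: abs_mult)
  also have "\<dots> \<le> (int p - 1) * 1" using J_0_abs by simp
  finally have "\<bar>J 1\<bar> \<le> 1" by (rule mult_left_le_imp_le) (use gt2 in simp)
  then have "(J 1)\<^sup>2 \<le> 1" by (simp add: abs_square_le_1)
  then have "(int p - 1) * (J 1)\<^sup>2 \<le> (int p - 1) * 1" using gt2 by (intro mult_left_mono) auto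
  moreover have "(J 0)\<^sup>2 \<le> (int p - 1)\<^sup>2"
    using power_mono[OF J_0_abs, of 2] by simp
  ultimately have "(\<Sum>w\<in>R. (J w)\<^sup>2) \<le> (int p - 1)\<^sup>2 + (int p - 1) * 1"
    using split[of power2] by simp
  also have "\<dots> \<le> (int p)\<^sup>2" using gt2 by (simp add: power2_eq_square algebra_simps)
  finally show ?thesis .
qed

text \<open>The four arguments form an additive quadruple. Fixing the common sum w = y + z separates
  the product, so the triple sum becomes the sum of the squares of \<open>J w\<close>. This is a
  saving of a factor p over the trivial bound p^3.\<close>

lemma sum_four_chi: "(\<Sum>x\<in>R. \<Sum>y\<in>R. \<Sum>z\<in>R. chi x * chi y * chi z * chi (y + z - x)) \<le> (int p)\<^sup>2"
proof -
  have *: "(\<Sum>z\<in>R. chi x * chi y * chi z * chi (y + z - x))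
      = (\<Sum>w\<in>R. (chi x * chi (w - x)) * (chi y * chi (w - y)))" for x y
  proof -
    have "(\<Sum>z\<in>R. chi x * chi y * chi z * chi (y + z - x))
        = (\<Sum>z\<in>R. (chi x * chi (1 * z + y - x)) * (chi y * chi (1 * z + y - y)))"
      by (intro sum.cong) (simp_all add: mult_ac add.commute)
    also have "\<dots> = (\<Sum>w\<in>R. (chi x * chi (w - x)) * (chi y * chi (w - y)))"
      by (rule sum_affine) (use gt2 in simp_all)
    finally show ?thesis .
  qed
  have "(\<Sum>x\<in>R. \<Sum>y\<in>R. \<Sum>z\<in>R. chi x * chi y * chi z * chi (y + z - x))
      = (\<Sum>x\<in>R. \<Sum>w\<in>R. \<Sum>y\<in>R. (chi x * chi (w - x)) * (chi y * chi (w - y)))"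
    unfolding * by (intro sum.cong refl sum.swap)
  also have "\<dots> = (\<Sum>w\<in>R. \<Sum>x\<in>R. \<Sum>y\<in>R. (chi x * chi (w - x)) * (chi y * chi (w - y)))"
    by (rule sum.swap)
  also have "\<dots> = (\<Sum>w\<in>R. (J w)\<^sup>2)"
    by (simp add: J_def power2_eq_square sum_product)
  finally show ?thesis using sum_J_square by simp
qed

(* Since (u + v) (u x\<^sup>2 + v y\<^sup>2) - (u x + v y)\<^sup>2 = u v (x - y)\<^sup>2, a common solution (x, y)
   determines the square root u v (x - y) of the discriminant. *)
lemma card_two_parabolas:
  assumes "\<not> int p dvd u" "\<not> int p dvd v" "\<not> int p dvd u + v"
  shows "int (card {(x, y). x \<in> R \<and> y \<in> R \<and> [u * x + v * y = a] (mod int p) \<and>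
           [u * x\<^sup>2 + v * y\<^sup>2 = b] (mod int p)}) \<le> 1 + chi u * chi v * chi ((u + v) * b - a\<^sup>2)"
    (is "int (card ?S) \<le> _")
proof -
  let ?D = "u * v * ((u + v) * b - a\<^sup>2)"
  let ?f = "\<lambda>(x, y). (u * v * (x - y)) mod int p"
  have "card ?S \<le> card {x \<in> R. [x\<^sup>2 = ?D] (mod int p)}"
  proof (rule card_inj_on_le[where f = ?f])
    show "inj_on ?f ?S"
    proof (rule inj_onI, clarify)
      fix x y x' y'
      assume R: "x \<in> R" "y \<in> R" "x' \<in> R" "y' \<in> R"
        and "[u * x + v * y = a] (mod int p)" "[u * x' + v * y' = a] (mod int p)"
        and eq: "(u * v * (x - y)) mod int p = (u * v * (x' - y')) mod int p"
      then have "[u * x + v * y = u * x' + v * y'] (mod int p)" by (metis cong_trans cong_sym)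
      then have 1: "int p dvd u * (x - x') + v * (y - y')"
        by (simp add: cong_iff_dvd_diff algebra_simps)
      have "int p dvd u * v * ((x - x') - (y - y'))" using eq by (simp add: mod_eq_dvd_iff algebra_simps)
      then have 2: "int p dvd (x - x') - (y - y')"
        using prime_int assms by (simp add: prime_dvd_mult_iff)
      have "int p dvd (u * (x - x') + v * (y - y')) + v * ((x - x') - (y - y'))"
        by (rule dvd_add[OF 1 dvd_mult[OF 2]])
      also have "\<dots> = (u + v) * (x - x')" by (simp add: algebra_simps)
      finally have 3: "int p dvd x - x'" using prime_int assms by (simp add: prime_dvd_mult_iff)
      then have "int p dvd y - y'" using 2 by (metis dvd_diff_right_iff dvd_minus_iff)
      then show "x = x' \<and> y = y'" using 3 R by (metis mod_eq_dvd_iff mod_pos_pos_trivial atLeastLessThan_iff)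
    qed
    show "?f ` ?S \<subseteq> {x \<in> R. [x\<^sup>2 = ?D] (mod int p)}"
    proof clarify
      fix x y assume xy: "[u * x + v * y = a] (mod int p)" "[u * x\<^sup>2 + v * y\<^sup>2 = b] (mod int p)"
      have "[((u * v * (x - y)) mod int p)\<^sup>2 = (u * v * (x - y))\<^sup>2] (mod int p)"
        by (intro cong_pow) (simp add: cong_def)
      also have "(u * v * (x - y))\<^sup>2 = u * v * ((u + v) * (u * x\<^sup>2 + v * y\<^sup>2) - (u * x + v * y)\<^sup>2)"
        by (simp add: power2_eq_square algebra_simps)
      also have "[\<dots> = ?D] (mod int p)" by (intro cong_mult cong_diff cong_pow xy cong_refl)
      finally show "(u * v * (x - y)) mod int p \<in> R \<and> [((u * v * (x - y)) mod int p)\<^sup>2 = ?D] (mod int p)"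
        using mod_in_R by simp
    qed
  qed (rule finite_subset[of _ R], auto)
  then show ?thesis using card_sqrt[of ?D] by (simp add: chi_mult)
qed

text \<open>\<open>det\<close> is the determinant of the three forms in (t, d, e), each with
  coefficient 1 at t. As it is invertible modulo p, the substitution permutes the residue triples:
  three parameters at non-collinear grid points are independent and uniform.\<close>

lemma sum_linear3:
  fixes f :: "int \<Rightarrow> int \<Rightarrow> int \<Rightarrow> int"
  assumes per: "\<And>x y z. f (x mod int p) (y mod int p) (z mod int p) = f x y z"
    and det: "\<not> int p dvd (a2 - a1) * (b3 - b1) - (b2 - b1) * (a3 - a1)"
  shows "(\<Sum>(t, d, e)\<in>R \<times> R \<times> R. f (t + a1 * d + b1 * e) (t + a2 * d + b2 * e) (t + a3 * d + b3 * e))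
       = (\<Sum>x\<in>R. \<Sum>y\<in>R. \<Sum>z\<in>R. f x y z)"
proof -
  let ?h = "\<lambda>(t, d, e). ((t + a1 * d + b1 * e) mod int p, (t + a2 * d + b2 * e) mod int p,
      (t + a3 * d + b3 * e) mod int p)"
  let ?det = "(a2 - a1) * (b3 - b1) - (b2 - b1) * (a3 - a1)"
  have "inj_on ?h (R \<times> R \<times> R)"
  proof (rule inj_onI)
    fix P Q assume PQ: "P \<in> R \<times> R \<times> R" "Q \<in> R \<times> R \<times> R" and eq: "?h P = ?h Q"
    obtain t d e t' d' e' where P: "P = (t, d, e)" and Q: "Q = (t', d', e')"
      using prod_cases3 by metis
    have R: "t \<in> R" "d \<in> R" "e \<in> R" "t' \<in> R" "d' \<in> R" "e' \<in> R"
      using PQ unfolding P Q by auto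
    from eq have "(t + a1 * d + b1 * e) mod int p = (t' + a1 * d' + b1 * e') mod int p"
      "(t + a2 * d + b2 * e) mod int p = (t' + a2 * d' + b2 * e') mod int p"
      "(t + a3 * d + b3 * e) mod int p = (t' + a3 * d' + b3 * e') mod int p"
      unfolding P Q by simp_all
    then have *: "int p dvd (t + a1 * d + b1 * e) - (t' + a1 * d' + b1 * e')"
      "int p dvd (t + a2 * d + b2 * e) - (t' + a2 * d' + b2 * e')"
      "int p dvd (t + a3 * d + b3 * e) - (t' + a3 * d' + b3 * e')"
      by (simp_all only: mod_eq_dvd_iff)
    define T D E where "T = t - t'" and "D = d - d'" and "E = e - e'"
    from * have 1: "int p dvd T + a1 * D + b1 * E" "int p dvd T + a2 * D + b2 * E" "int p dvd T + a3 * D + b3 * E"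
      by (simp_all add: T_def D_def E_def algebra_simps)
    have 2: "int p dvd (a2 - a1) * D + (b2 - b1) * E" "int p dvd (a3 - a1) * D + (b3 - b1) * E"
      using dvd_diff[OF 1(2) 1(1)] dvd_diff[OF 1(3) 1(1)] by (simp_all add: algebra_simps)
    \<comment> \<open>Cramer's rule for the two relations left after eliminating \<open>T\<close>:
      this combination isolates the determinant times \<open>D\<close>, and the next one the
      determinant times \<open>E\<close>.\<close>
    have "int p dvd (b3 - b1) * ((a2 - a1) * D + (b2 - b1) * E) - (b2 - b1) * ((a3 - a1) * D + (b3 - b1) * E)"
      using 2 by (intro dvd_diff dvd_mult)
    also have "\<dots> = ?det * D" by (simp add: algebra_simps)
    finally have D: "int p dvd D" using prime_int det by (simp add: prime_dvd_mult_iff)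
    have "int p dvd (a2 - a1) * ((a3 - a1) * D + (b3 - b1) * E) - (a3 - a1) * ((a2 - a1) * D + (b2 - b1) * E)"
      using 2 by (intro dvd_diff dvd_mult)
    also have "\<dots> = ?det * E" by (simp add: algebra_simps)
    finally have E: "int p dvd E" using prime_int det by (simp add: prime_dvd_mult_iff)
    have "int p dvd (T + a1 * D + b1 * E) - (a1 * D + b1 * E)"
      by (rule dvd_diff[OF 1(1) dvd_add[OF dvd_mult[OF D] dvd_mult[OF E]]])
    then have "int p dvd T" by simp
    with D E show "P = Q" using R unfolding T_def D_def E_def P Q
      by (metis mod_eq_dvd_iff mod_pos_pos_trivial atLeastLessThan_iff)
  qed
  moreover have "?h ` (R \<times> R \<times> R) \<subseteq> R \<times> R \<times> R" using mod_in_R by auto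
  ultimately have "bij_betw ?h (R \<times> R \<times> R) (R \<times> R \<times> R)"
    unfolding bij_betw_def by (intro conjI endo_inj_surj) auto
  from sum.reindex_bij_betw[OF this, of "\<lambda>(x, y, z). f x y z"]
  show ?thesis by (simp only: case_prod_unfold per sum.cartesian_product fst_conv snd_conv)
qed

end

section \<open>Second moment of the character convolution and choice of the parameters\<close>

context odd_prime
begin

(* Grid points are triples (n, a, b): n is the coarse position in the interval, and at
   w = (t, d, e) the pair (a, b) gives the curve parameter t + a d + b e. *)
definition lin :: "int \<times> int \<times> int \<Rightarrow> int \<times> int \<times> int \<Rightarrow> int" where
  "lin w i = fst w + fst (snd i) * fst (snd w) + snd (snd i) * snd (snd w)"

definition chi_conv :: "(int \<times> int \<times> int) set \<Rightarrow> int \<times> int \<times> int \<Rightarrow> int \<times> int \<times> int \<Rightarrow> int" where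
  "chi_conv A w k = (\<Sum>i\<in>A. if k - i \<in> A then chi (lin w i) * chi (lin w (k - i)) else 0)"

text \<open>Up to sign, twice the area of the triangle spanned by the (a, b) coordinates of the
  three points, so it vanishes exactly on collinear triples. It is the determinant required by
  \<open>sum_linear3\<close>.\<close>

definition cross :: "int \<times> int \<times> int \<Rightarrow> int \<times> int \<times> int \<Rightarrow> int \<times> int \<times> int \<Rightarrow> int" where
  "cross i j k = (fst (snd j) - fst (snd i)) * (snd (snd k) - snd (snd i))
     - (snd (snd j) - snd (snd i)) * (fst (snd k) - fst (snd i))"

abbreviation sumset :: "(int \<times> int \<times> int) set \<Rightarrow> (int \<times> int \<times> int) set" where
  "sumset A \<equiv> (\<lambda>(i, j). i + j) ` (A \<times> A)"

lemma lin_diff: "lin w (j + k - i) = lin w j + lin w k - lin w i"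
  by (simp add: lin_def algebra_simps)

text \<open>Groups pairs by their sum. The weight \<open>g\<close> will be \<open>chi_conv\<close>
  itself in the second moment, and the remaining character of the parabola count in
  \<open>card_curve_sums\<close>.\<close>

lemma sum_chi_conv_mult:
  assumes A: "finite A"
  shows "(\<Sum>k\<in>sumset A. g k * chi_conv A w k) = (\<Sum>(i, j)\<in>A \<times> A. g (i + j) * (chi (lin w i) * chi (lin w j)))"
proof -
  have "g k * chi_conv A w k = (\<Sum>(i, j) | (i, j) \<in> A \<times> A \<and> i + j = k. g (i + j) * (chi (lin w i) * chi (lin w j)))" for k
  proof -
    have "(\<Sum>(i, j) | (i, j) \<in> A \<times> A \<and> i + j = k. g (i + j) * (chi (lin w i) * chi (lin w j)))
      = (\<Sum>i\<in>{i \<in> A. k - i \<in> A}. g k * (chi (lin w i) * chi (lin w (k - i))))"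
      by (rule sum.reindex_bij_witness[of _ "\<lambda>i. (i, k - i)" fst]) auto
    also have "\<dots> = g k * chi_conv A w k"
      unfolding chi_conv_def sum_distrib_left using A by (intro sum.mono_neutral_cong_left) auto
    finally show ?thesis by simp
  qed
  then have "(\<Sum>k\<in>sumset A. g k * chi_conv A w k)
    = (\<Sum>k\<in>sumset A. \<Sum>x\<in>{x \<in> A \<times> A. (\<lambda>(i, j). i + j) x = k}. (\<lambda>(i, j). g (i + j) * (chi (lin w i) * chi (lin w j))) x)"
    by (intro sum.cong refl) (simp, intro sum.cong, auto)
  also have "\<dots> = (\<Sum>x\<in>A \<times> A. (\<lambda>(i, j). g (i + j) * (chi (lin w i) * chi (lin w j))) x)"
    using A by (intro sum.group) auto
  finally show ?thesis .
qed

text \<open>The square expands into quadruples with i + i' = j + k, and since \<open>lin\<close> is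
  affine the fourth parameter is \<open>lin w j + lin w k - lin w i\<close>. For non-collinear i, j,
  k the average over w is the sum in \<open>sum_four_chi\<close>, at most p^2; collinear triples
  receive the trivial bound p^3. The bound on \<open>cross\<close> ensures that non-collinear
  triples stay non-collinear modulo p.\<close>

lemma second_moment:
  assumes A: "finite A"
    and det: "\<And>i j k. i \<in> A \<Longrightarrow> j \<in> A \<Longrightarrow> k \<in> A \<Longrightarrow> \<bar>cross i j k\<bar> < int p"
  shows "(\<Sum>w\<in>R \<times> R \<times> R. \<Sum>k\<in>sumset A. (chi_conv A w k)\<^sup>2)
    \<le> (int p) ^ 3 * int (card {(i, j, k). i \<in> A \<and> j \<in> A \<and> k \<in> A \<and> cross i j k = 0})
      + (int p)\<^sup>2 * int (card A) ^ 3"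
proof -
  let ?F = "\<lambda>w (i, j, k). if j + k - i \<in> A then chi (lin w i) * chi (lin w j) * chi (lin w k) * chi (lin w (j + k - i)) else 0"
  let ?D = "{x \<in> A \<times> A \<times> A. (\<lambda>(i, j, k). cross i j k = 0) x}"
  have "(\<Sum>k\<in>sumset A. (chi_conv A w k)\<^sup>2) = (\<Sum>x\<in>A \<times> A \<times> A. ?F w x)" for w
  proof -
    have "(\<Sum>k\<in>sumset A. (chi_conv A w k)\<^sup>2) = (\<Sum>(j, k)\<in>A \<times> A. chi_conv A w (j + k) * (chi (lin w j) * chi (lin w k)))"
      using sum_chi_conv_mult[OF A, of "chi_conv A w" w] by (simp add: power2_eq_square)
    also have "\<dots> = (\<Sum>(j, k)\<in>A \<times> A. \<Sum>i\<in>A. ?F w (i, j, k))"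
      unfolding chi_conv_def sum_distrib_right by (intro sum.cong refl) (auto intro!: sum.cong)
    also have "\<dots> = (\<Sum>i\<in>A. \<Sum>(j, k)\<in>A \<times> A. ?F w (i, j, k))"
      unfolding case_prod_unfold by (rule sum.swap)
    finally show ?thesis by (simp only: sum.cartesian_product case_prod_unfold fst_conv snd_conv)
  qed
  then have "(\<Sum>w\<in>R \<times> R \<times> R. \<Sum>k\<in>sumset A. (chi_conv A w k)\<^sup>2)
      = (\<Sum>x\<in>A \<times> A \<times> A. \<Sum>w\<in>R \<times> R \<times> R. ?F w x)"
    by (simp only: sum.swap[of _ "A \<times> A \<times> A"])
  also have "\<dots> \<le> (\<Sum>x\<in>A \<times> A \<times> A. (if x \<in> ?D then (int p) ^ 3 else 0) + (int p)\<^sup>2)"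
  proof (intro sum_mono)
    fix x assume x: "x \<in> A \<times> A \<times> A"
    obtain i j k where ijk: "x = (i, j, k)" using prod_cases3 by metis
    have bound: "?F w x \<le> 1" for w
    proof -
      have "?F w x = (if j + k - i \<in> A then chi (lin w i * lin w j * lin w k * lin w (j + k - i)) else 0)"
        by (simp add: ijk chi_mult)
      then show ?thesis using chi_abs_le[of "lin w i * lin w j * lin w k * lin w (j + k - i)"] by (simp add: abs_le_iff)
    qed
    show "(\<Sum>w\<in>R \<times> R \<times> R. ?F w x) \<le> (if x \<in> ?D then (int p) ^ 3 else 0) + (int p)\<^sup>2"
    proof (cases "x \<in> ?D")
      case True
      have "(\<Sum>w\<in>R \<times> R \<times> R. ?F w x) \<le> (\<Sum>w\<in>R \<times> R \<times> R. 1)"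
        by (rule sum_mono) (rule bound)
      also have "\<dots> = int p ^ 3" by (simp add: card_cartesian_product power3_eq_cube)
      finally have "(\<Sum>w\<in>R \<times> R \<times> R. ?F w x) \<le> int p ^ 3" .
      also have "\<dots> \<le> int p ^ 3 + (int p)\<^sup>2" by simp
      finally show ?thesis using True by (simp only: if_True)
    next
      case False
      then have "cross i j k \<noteq> 0" using x ijk by auto
      then have nd: "\<not> int p dvd cross i j k" using det[of i j k] dvd_small x ijk by auto
      let ?f = "\<lambda>x y z. chi x * chi y * chi z * chi (y + z - x)"
      have per: "?f (x mod int p) (y mod int p) (z mod int p) = ?f x y z" for x y z
      proof -
        have "chi (y mod int p + z mod int p - x mod int p) = chi (y + z - x)"
          by (intro chi_cong cong_diff cong_add) (simp_all add: cong_def)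
        then show ?thesis by simp
      qed
      have "(\<Sum>w\<in>R \<times> R \<times> R. ?f (lin w i) (lin w j) (lin w k)) = (\<Sum>x\<in>R. \<Sum>y\<in>R. \<Sum>z\<in>R. ?f x y z)"
        using sum_linear3[of ?f, OF per nd[unfolded cross_def]]
        by (simp only: lin_def case_prod_unfold)
      also have "\<dots> \<le> (int p)\<^sup>2" by (rule sum_four_chi)
      finally have "(\<Sum>w\<in>R \<times> R \<times> R. ?F w x) \<le> (int p)\<^sup>2"
        unfolding ijk by (cases "j + k - i \<in> A") (simp_all add: lin_diff)
      then show ?thesis using False by (simp only: if_False add_0)
    qed
  qed
  also have "\<dots> = (int p) ^ 3 * int (card ?D) + (int p)\<^sup>2 * int (card A) ^ 3"
    using A by (simp add: sum.distrib sum.If_cases card_cartesian_product power3_eq_cube Int_def conj_commute)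
  also have "?D = {(i, j, k). i \<in> A \<and> j \<in> A \<and> k \<in> A \<and> cross i j k = 0}" by auto
  finally show ?thesis .
qed

text \<open>Some coefficient is invertible modulo p, so the other two coordinates of a zero
  determine the third.\<close>

lemma card_linear_form:
  assumes "\<not> (int p dvd c0 \<and> int p dvd c1 \<and> int p dvd c2)"
  shows "card {(t, d, e) \<in> R \<times> R \<times> R. int p dvd c0 * t + c1 * d + c2 * e} \<le> p\<^sup>2"
    (is "card ?S \<le> _")
proof -
  have inj: "x = y" if "\<not> int p dvd c" "int p dvd c * x + r" "int p dvd c * y + r" "x \<in> R" "y \<in> R" for c x y r
  proof -
    have "int p dvd c * (x - y)" using dvd_diff[OF that(2,3)] by (simp add: algebra_simps)
    then have "int p dvd x - y" using prime_int that(1) by (simp add: prime_dvd_mult_iff)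
    then show ?thesis using that(4,5) dvd_small[of "x - y"] by auto
  qed
  have inj': "inj_on f ?S \<Longrightarrow> f ` ?S \<subseteq> R \<times> R \<Longrightarrow> card ?S \<le> p\<^sup>2" for f
    using card_inj_on_le[of f ?S "R \<times> R"] by (simp add: card_cartesian_product power2_eq_square)
  consider "\<not> int p dvd c0" | "\<not> int p dvd c1" | "\<not> int p dvd c2" using assms by blast
  then show ?thesis
  proof cases
    case 1
    show ?thesis
    proof (rule inj'[of "\<lambda>(t, d, e). (d, e)"])
      have "x = y" if "int p dvd c0 * x + c1 * d + c2 * e" "int p dvd c0 * y + c1 * d + c2 * e" "x \<in> R" "y \<in> R" for x y d e
        using inj[OF 1, of x "c1 * d + c2 * e" y] that by (simp add: algebra_simps)
      then show "inj_on (\<lambda>(t, d, e). (d, e)) ?S" by (intro inj_onI) auto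
    qed auto
  next
    case 2
    show ?thesis
    proof (rule inj'[of "\<lambda>(t, d, e). (t, e)"])
      have "x = y" if "int p dvd c0 * t + c1 * x + c2 * e" "int p dvd c0 * t + c1 * y + c2 * e" "x \<in> R" "y \<in> R" for x y t e
        using inj[OF 2, of x "c0 * t + c2 * e" y] that by (simp add: algebra_simps)
      then show "inj_on (\<lambda>(t, d, e). (t, e)) ?S" by (intro inj_onI) auto
    qed auto
  next
    case 3
    show ?thesis
    proof (rule inj'[of "\<lambda>(t, d, e). (t, d)"])
      have "x = y" if "int p dvd c0 * t + c1 * d + c2 * x" "int p dvd c0 * t + c1 * d + c2 * y" "x \<in> R" "y \<in> R" for x y t d
        using inj[OF 3, of x "c0 * t + c1 * d" y] that by (simp add: algebra_simps)
      then show "inj_on (\<lambda>(t, d, e). (t, d)) ?S" by (intro inj_onI) auto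
    qed auto
  qed
qed

text \<open>The first two conditions are the hypotheses of \<open>card_two_parabolas\<close>. The
  third keeps the parabolas of different (a, b) distinct; it is restricted to
  \<open>snd i \<noteq> snd j\<close> because \<open>lin\<close> ignores the coarse
  position.\<close>

definition good :: "(int \<times> int \<times> int) set \<Rightarrow> int \<times> int \<times> int \<Rightarrow> bool" where
  "good A w \<longleftrightarrow> (\<forall>i\<in>A. \<not> int p dvd lin w i) \<and> (\<forall>i\<in>A. \<forall>j\<in>A. \<not> int p dvd lin w i + lin w j) \<and>
     (\<forall>i\<in>A. \<forall>j\<in>A. snd i \<noteq> snd j \<longrightarrow> \<not> int p dvd lin w i - lin w j)"

text \<open>Union bound over pairs: each of the three ways to fail is a zero of a linear form in (t,
  d, e) that is nonzero modulo p. Its coefficient at t is 1 or 2 in the first two cases; in the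
  third the coefficients are small differences, not both zero.\<close>

lemma card_not_good:
  assumes A: "finite A" and small: "\<And>i j. i \<in> A \<Longrightarrow> j \<in> A \<Longrightarrow>
      \<bar>fst (snd i) - fst (snd j)\<bar> < int p \<and> \<bar>snd (snd i) - snd (snd j)\<bar> < int p"
  shows "card {w \<in> R \<times> R \<times> R. \<not> good A w} \<le> 3 * (card A)\<^sup>2 * p\<^sup>2"
proof -
  let ?Z = "\<lambda>c0 c1 c2. {(t, d, e) \<in> R \<times> R \<times> R. int p dvd c0 * t + c1 * d + c2 * e}"
  let ?S1 = "\<lambda>(i, j). ?Z 1 (fst (snd i)) (snd (snd i))"
  let ?S2 = "\<lambda>(i, j). ?Z 2 (fst (snd i) + fst (snd j)) (snd (snd i) + snd (snd j))"
  let ?S3 = "\<lambda>(i, j). if snd i \<noteq> snd j then ?Z 0 (fst (snd i) - fst (snd j)) (snd (snd i) - snd (snd j)) else {}"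
  have n2: "\<not> int p dvd 2" and n1: "\<not> int p dvd 1" using gt2 by (auto dest: zdvd_imp_le)
  have fin: "finite (?Z c0 c1 c2)" for c0 c1 c2
    by (rule finite_subset[of _ "R \<times> R \<times> R"]) auto
  have c1: "card (?S1 (i, j)) \<le> p\<^sup>2" for i j
    unfolding prod.case by (rule card_linear_form) (use n1 in simp)
  have c2: "card (?S2 (i, j)) \<le> p\<^sup>2" for i j
    unfolding prod.case by (rule card_linear_form) (use n2 in simp)
  have c3: "card (?S3 (i, j)) \<le> p\<^sup>2" if "i \<in> A" "j \<in> A" for i j
  proof (cases "snd i = snd j")
    case False
    then have "fst (snd i) - fst (snd j) \<noteq> 0 \<or> snd (snd i) - snd (snd j) \<noteq> 0"
      by (simp add: prod_eq_iff)
    then have "\<not> (int p dvd fst (snd i) - fst (snd j) \<and> int p dvd snd (snd i) - snd (snd j))"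
      using small[OF that] dvd_small by blast
    then have "card (?Z 0 (fst (snd i) - fst (snd j)) (snd (snd i) - snd (snd j))) \<le> p\<^sup>2"
      by (intro card_linear_form) simp
    then show ?thesis using False by (simp only: prod.case if_True not_False_eq_True)
  qed simp
  have "{w \<in> R \<times> R \<times> R. \<not> good A w} \<subseteq> (\<Union>x\<in>A \<times> A. ?S1 x \<union> ?S2 x \<union> ?S3 x)"
  proof
    fix w assume "w \<in> {w \<in> R \<times> R \<times> R. \<not> good A w}"
    then have w: "w \<in> R \<times> R \<times> R" "\<not> good A w" by auto
    obtain t d e where tde: "w = (t, d, e)" using prod_cases3 by metis
    from w(2) consider i where "i \<in> A" "int p dvd lin w i"
      | i j where "i \<in> A" "j \<in> A" "int p dvd lin w i + lin w j"
      | i j where "i \<in> A" "j \<in> A" "snd i \<noteq> snd j" "int p dvd lin w i - lin w j"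
      unfolding good_def by blast
    then show "w \<in> (\<Union>x\<in>A \<times> A. ?S1 x \<union> ?S2 x \<union> ?S3 x)"
    proof cases
      case 1
      then have "w \<in> ?S1 (i, i)" using w(1) by (simp add: tde lin_def)
      then show ?thesis using 1 by blast
    next
      case 2
      then have "w \<in> ?S2 (i, j)" using w(1) by (simp add: tde lin_def algebra_simps)
      then show ?thesis using 2 by blast
    next
      case 3
      then have "w \<in> ?S3 (i, j)" using w(1) by (simp add: tde lin_def algebra_simps)
      then show ?thesis using 3 by blast
    qed
  qed
  then have "card {w \<in> R \<times> R \<times> R. \<not> good A w} \<le> card (\<Union>x\<in>A \<times> A. ?S1 x \<union> ?S2 x \<union> ?S3 x)"
    using A fin by (intro card_mono finite_UN_I) (auto simp: case_prod_unfold simp del: mem_Sigma_iff)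
  also have "\<dots> \<le> (\<Sum>x\<in>A \<times> A. card (?S1 x \<union> ?S2 x \<union> ?S3 x))"
    using A by (intro card_UN_le) simp
  also have "\<dots> \<le> (\<Sum>x\<in>A \<times> A. 3 * p\<^sup>2)"
  proof (intro sum_mono)
    fix x assume "x \<in> A \<times> A"
    then obtain i j where x: "x = (i, j)" "i \<in> A" "j \<in> A" by auto
    have "card (?S1 x \<union> ?S2 x \<union> ?S3 x) \<le> card (?S1 x) + card (?S2 x) + card (?S3 x)"
      by (meson card_Un_le add_right_mono order_trans)
    also have "\<dots> \<le> p\<^sup>2 + p\<^sup>2 + p\<^sup>2" unfolding x(1) by (intro add_mono c1 c2 c3 x)
    finally show "card (?S1 x \<union> ?S2 x \<union> ?S3 x) \<le> 3 * p\<^sup>2" by simp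
  qed
  also have "\<dots> = 3 * (card A)\<^sup>2 * p\<^sup>2" by (simp add: card_cartesian_product power2_eq_square)
  finally show ?thesis .
qed

text \<open>An averaging argument. Since 6 K^2 \<le> p for K = \<open>card A\<close>, at least half
  of all w are good. Since K^3 \<le> p, the second moment averaged over all w is at most D + 1.
  Hence some good w has second moment at most twice that. The condition on \<open>B\<close> bounds
  \<open>cross\<close> by p.\<close>

lemma good_exists:
  assumes A: "finite A" and B: "\<And>i. i \<in> A \<Longrightarrow> snd i \<in> {0..<B} \<times> {0..<B}"
    and pB: "2 * B\<^sup>2 \<le> int p" "6 * (card A) ^ 3 \<le> p"
    and D: "card {(i, j, k). i \<in> A \<and> j \<in> A \<and> k \<in> A \<and> cross i j k = 0} \<le> D"
  shows "\<exists>w. good A w \<and> (\<Sum>k\<in>sumset A. (chi_conv A w k)\<^sup>2) \<le> 2 * int (D + 1)"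
proof (rule ccontr)
  assume no: "\<not> ?thesis"
  let ?G = "{w \<in> R \<times> R \<times> R. good A w}"
  have diff: "\<bar>fst (snd i) - fst (snd j)\<bar> < B \<and> \<bar>snd (snd i) - snd (snd j)\<bar> < B"
    if "i \<in> A" "j \<in> A" for i j using B[OF that(1)] B[OF that(2)] by (auto simp: mem_Times_iff)
  have BB: "B \<le> 2 * B\<^sup>2" if "B > 0" using that by (simp add: power2_eq_square)
  have small: "\<bar>fst (snd i) - fst (snd j)\<bar> < int p \<and> \<bar>snd (snd i) - snd (snd j)\<bar> < int p"
    if "i \<in> A" "j \<in> A" for i j
    using diff[OF that] BB pB(1) by linarith
  have det: "\<bar>cross i j k\<bar> < int p" if "i \<in> A" "j \<in> A" "k \<in> A" for i j k
  proof -
    have m: "\<bar>x * y\<bar> < B\<^sup>2" if "\<bar>x\<bar> < B" "\<bar>y\<bar> < B" for x y :: int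
      unfolding abs_mult power2_eq_square using that by (intro mult_strict_mono) auto
    have "\<bar>cross i j k\<bar> \<le> \<bar>(fst (snd j) - fst (snd i)) * (snd (snd k) - snd (snd i))\<bar>
       + \<bar>(snd (snd j) - snd (snd i)) * (fst (snd k) - fst (snd i))\<bar>"
      unfolding cross_def by (rule abs_triangle_ineq4)
    also have "\<dots> < B\<^sup>2 + B\<^sup>2"
      using diff that by (intro add_strict_mono m) auto
    finally show ?thesis using pB(1) by simp
  qed
  define K where "K = card A"
  have fin: "finite (R \<times> R \<times> R)" by simp
  have "R \<times> R \<times> R = ?G \<union> {w \<in> R \<times> R \<times> R. \<not> good A w}" by blast
  then have "card (R \<times> R \<times> R) = card (?G \<union> {w \<in> R \<times> R \<times> R. \<not> good A w})" by (rule arg_cong)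
  also have "\<dots> = card ?G + card {w \<in> R \<times> R \<times> R. \<not> good A w}"
    using fin by (intro card_Un_disjoint) (blast intro: rev_finite_subset)+
  finally have "int (card ?G) + int (card {w \<in> R \<times> R \<times> R. \<not> good A w}) = int (card (R \<times> R \<times> R))"
    by (simp only: of_nat_add)
  also have "\<dots> = int p ^ 3" by (simp add: card_cartesian_product power3_eq_cube)
  finally have G: "int (card ?G) = int p ^ 3 - int (card {w \<in> R \<times> R \<times> R. \<not> good A w})" by simp
  have "card {w \<in> R \<times> R \<times> R. \<not> good A w} \<le> 3 * K\<^sup>2 * p\<^sup>2"
    unfolding K_def by (rule card_not_good[OF A small])
  then have "int (card {w \<in> R \<times> R \<times> R. \<not> good A w}) \<le> int (3 * K\<^sup>2 * p\<^sup>2)" by (simp only: of_nat_le_iff)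
  then have G2: "2 * int (card ?G) \<ge> 2 * int p ^ 3 - int (6 * K\<^sup>2) * (int p)\<^sup>2" using G by simp
  have "K\<^sup>2 \<le> K ^ 3" by (cases K) (auto simp: power2_eq_square power3_eq_cube)
  then have "6 * K\<^sup>2 \<le> p" using pB(2) unfolding K_def by linarith
  then have "int (6 * K\<^sup>2) * (int p)\<^sup>2 \<le> int p * (int p)\<^sup>2" by (intro mult_right_mono) (simp_all only: of_nat_le_iff zero_le_power2)
  then have G3: "2 * int (card ?G) \<ge> int p ^ 3" using G2 by (simp add: power3_eq_cube power2_eq_square)
  have "int (card ?G) * (2 * int (D + 1) + 1) = (\<Sum>w\<in>?G. 2 * int (D + 1) + 1)" by simp
  also have "\<dots> \<le> (\<Sum>w\<in>?G. \<Sum>k\<in>sumset A. (chi_conv A w k)\<^sup>2)"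
  proof (intro sum_mono)
    fix w assume "w \<in> ?G"
    then have "\<not> (\<Sum>k\<in>sumset A. (chi_conv A w k)\<^sup>2) \<le> 2 * int (D + 1)" using no by blast
    then show "2 * int (D + 1) + 1 \<le> (\<Sum>k\<in>sumset A. (chi_conv A w k)\<^sup>2)" by linarith
  qed
  also have "\<dots> \<le> (\<Sum>w\<in>R \<times> R \<times> R. \<Sum>k\<in>sumset A. (chi_conv A w k)\<^sup>2)"
    using fin by (intro sum_mono2) (auto intro: sum_nonneg)
  also have "\<dots> \<le> (int p) ^ 3 * int (card {(i, j, k). i \<in> A \<and> j \<in> A \<and> k \<in> A \<and> cross i j k = 0})
      + (int p)\<^sup>2 * int K ^ 3" unfolding K_def by (rule second_moment[OF A det])
  also have "\<dots> \<le> (int p) ^ 3 * int D + (int p)\<^sup>2 * int p"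
  proof (intro add_mono mult_left_mono)
    have "K ^ 3 \<le> p" using pB(2) unfolding K_def by linarith
    then show "int K ^ 3 \<le> int p" by (simp flip: of_nat_power)
  qed (use D in simp_all)
  also have "\<dots> = int p ^ 3 * int (D + 1)" by (simp add: power3_eq_cube power2_eq_square algebra_simps)
  finally have 1: "int (card ?G) * (2 * int (D + 1) + 1) \<le> int p ^ 3 * int (D + 1)" .
  have "int p ^ 3 * int (D + 1) \<le> 2 * int (card ?G) * int (D + 1)" by (intro mult_right_mono G3) simp
  with 1 have "int (card ?G) * (2 * int (D + 1) + 1) \<le> 2 * int (card ?G) * int (D + 1)" by (rule order_trans)
  moreover have "c * (2 * x + 1) \<le> 2 * c * x \<Longrightarrow> c \<le> 0" for c x :: int by (simp add: algebra_simps)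
  ultimately have "int (card ?G) \<le> 0" by blast
  moreover have "int p ^ 3 > 0" using gt2 by simp
  ultimately show False using G3 by linarith
qed

end

section \<open>From curves to sets of integers\<close>

text \<open>Summing \<open>card_two_parabolas\<close> over the pairs (i, j) gives a main term, one
  per pair, and a character term. In the latter the third character depends only on k = i + j, so it
  becomes a coefficient of absolute value at most 1 in front of
  \<open>chi_conv A w k\<close>.\<close>

lemma (in odd_prime) card_curve_sums:
  assumes A: "finite A" and good: "good A w"
  shows "int (card {((i, x), (j, y)). i \<in> A \<and> j \<in> A \<and> x \<in> R \<and> y \<in> R \<and> fst i + fst j = n \<and>
        [lin w i * x + lin w j * y = a] (mod int p) \<and> [lin w i * x\<^sup>2 + lin w j * y\<^sup>2 = b] (mod int p)})
     \<le> int (card {(i, j) \<in> A \<times> A. fst i + fst j = n}) + (\<Sum>k | k \<in> sumset A \<and> fst k = n. \<bar>chi_conv A w k\<bar>)"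
    (is "int (card ?S) \<le> _")
proof -
  let ?P = "{(i, j) \<in> A \<times> A. fst i + fst j = n}"
  let ?C = "\<lambda>i j. {(x, y). x \<in> R \<and> y \<in> R \<and> [lin w i * x + lin w j * y = a] (mod int p) \<and>
           [lin w i * x\<^sup>2 + lin w j * y\<^sup>2 = b] (mod int p)}"
  \<comment> \<open>The parameter sum as a function of k = i + j; the offset t enters twice.\<close>
  define h where "h k = 2 * fst w + fst (snd k) * fst (snd w) + snd (snd k) * snd (snd w)" for k :: "int \<times> int \<times> int"
  \<comment> \<open>Setting \<open>g\<close> to 0 off the level n lets the sum run over all of
    \<open>A \<times> A\<close>, as the regrouping lemma requires.\<close>
  define g where "g k = (if fst k = n then chi (h k * b - a\<^sup>2) else 0)" for k
  have h: "lin w i + lin w j = h (i + j)" for i j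
    by (simp add: h_def lin_def algebra_simps)
  have finP: "finite ?P" using A by (rule_tac finite_subset[of _ "A \<times> A"]) auto
  have finC: "finite (?C i j)" for i j by (rule finite_subset[of _ "R \<times> R"]) auto
  have "?S \<subseteq> (\<Union>(i, j)\<in>?P. (\<lambda>(x, y). ((i, x), (j, y))) ` ?C i j)" by auto
  then have "card ?S \<le> card (\<Union>(i, j)\<in>?P. (\<lambda>(x, y). ((i, x), (j, y))) ` ?C i j)"
    using finP finC by (intro card_mono finite_UN_I) auto
  also have "\<dots> \<le> (\<Sum>(i, j)\<in>?P. card (?C i j))"
  proof (rule order_trans[OF card_UN_le[OF finP]], rule sum_mono)
    fix x assume "x \<in> ?P"
    obtain i j where x: "x = (i, j)" by (cases x)
    show "card (case x of (i, j) \<Rightarrow> (\<lambda>(x, y). ((i, x), (j, y))) ` ?C i j) \<le> (case x of (i, j) \<Rightarrow> card (?C i j))"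
      unfolding x prod.case by (rule card_image_le[OF finC])
  qed
  finally have "int (card ?S) \<le> (\<Sum>(i, j)\<in>?P. int (card (?C i j)))"
    by (simp only: of_nat_le_iff of_nat_sum case_prod_unfold flip: of_nat_sum)
  also have "\<dots> \<le> (\<Sum>(i, j)\<in>?P. 1 + g (i + j) * (chi (lin w i) * chi (lin w j)))"
  proof (intro sum_mono, clarify)
    fix i j assume ij: "i \<in> A" "j \<in> A" "n = fst i + fst j"
    have "int (card (?C i j)) \<le> 1 + chi (lin w i) * chi (lin w j) * chi ((lin w i + lin w j) * b - a\<^sup>2)"
      using good ij by (intro card_two_parabolas) (auto simp: good_def)
    then show "int (card (?C i j)) \<le> 1 + g (i + j) * (chi (lin w i) * chi (lin w j))"
      using ij(3) by (simp add: g_def h mult_ac)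
  qed
  also have "\<dots> = int (card ?P) + (\<Sum>(i, j)\<in>?P. g (i + j) * (chi (lin w i) * chi (lin w j)))"
    by (simp add: case_prod_unfold sum.distrib)
  also have "(\<Sum>(i, j)\<in>?P. g (i + j) * (chi (lin w i) * chi (lin w j)))
      = (\<Sum>(i, j)\<in>A \<times> A. g (i + j) * (chi (lin w i) * chi (lin w j)))"
    using A by (intro sum.mono_neutral_left) (auto simp: g_def split: if_splits)
  also have "\<dots> = (\<Sum>k\<in>sumset A. g k * chi_conv A w k)"
    by (rule sum_chi_conv_mult[OF A, symmetric])
  also have "\<dots> = (\<Sum>k | k \<in> sumset A \<and> fst k = n. g k * chi_conv A w k)"
    using A by (intro sum.mono_neutral_right) (auto simp: g_def)
  also have "\<dots> \<le> (\<Sum>k | k \<in> sumset A \<and> fst k = n. \<bar>chi_conv A w k\<bar>)"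
  proof (intro sum_mono)
    fix k
    have "g k * chi_conv A w k \<le> \<bar>g k\<bar> * \<bar>chi_conv A w k\<bar>" by (simp flip: abs_mult)
    also have "\<dots> \<le> 1 * \<bar>chi_conv A w k\<bar>"
      by (intro mult_right_mono) (simp_all add: g_def chi_abs_le)
    finally show "g k * chi_conv A w k \<le> \<bar>chi_conv A w k\<bar>" by simp
  qed
  finally show ?thesis by simp
qed

(* Passing from residues modulo p to integers, the carry of the lowest digit is absorbed by an
   additional digit c < s running over all values. *)
lemma card_lift_pairs:
  fixes X \<rho> :: "'a \<Rightarrow> int" and p s :: int
  assumes D: "finite D" and X: "\<And>d. d \<in> D \<Longrightarrow> 0 \<le> X d \<and> X d < p" and s: "0 < s"
    and bound: "\<And>a r. card {(d, d'). d \<in> D \<and> d' \<in> D \<and> Q d d' \<and> [X d + X d' = a] (mod p) \<and> \<rho> d + \<rho> d' = r} \<le> m"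
  shows "card {((d, c), (d', c')). d \<in> D \<and> d' \<in> D \<and> c \<in> {0..<s} \<and> c' \<in> {0..<s} \<and> Q d d' \<and>
     (X d + p * (c + s * \<rho> d)) + (X d' + p * (c' + s * \<rho> d')) = v} \<le> (nat s + 1) * m"
    (is "card ?S \<le> _")
proof (cases "D = {}")
  case False
  then have p: "p > 0" using X by force
  define z where "z = v div p"
  \<comment> \<open>The possible pairs (c, r), at most s + 1 in number. The value fixes z = e + c +
    c' + s r with carry e in {0, 1}. If e + c' < s, then c determines r; otherwise e = 1 and c' = s
    - 1, so c = z mod s, and this is the single additional pair.\<close>
  define I where "I = (\<lambda>c. (c, (z - c) div s)) ` {0..<s} \<union> {(z mod s, (z - 1 - z mod s) div s)}"
  define T where "T r = {(d, d'). d \<in> D \<and> d' \<in> D \<and> Q d d' \<and> [X d + X d' = v] (mod p) \<and> \<rho> d + \<rho> d' = r}" for r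
  have finT: "finite (T r)" for r unfolding T_def by (rule finite_subset[of _ "D \<times> D"]) (use D in auto)
  have finI: "finite I" by (simp add: I_def)
  have cardI: "card I \<le> nat s + 1"
  proof -
    have "card I \<le> card ((\<lambda>c. (c, (z - c) div s)) ` {0..<s}) + card {(z mod s, (z - 1 - z mod s) div s)}"
      unfolding I_def by (rule card_Un_le)
    also have "\<dots> \<le> card {0..<s} + 1" by (intro add_mono card_image_le) auto
    finally show ?thesis by simp
  qed
  \<comment> \<open>The digit c' need not be recorded, because the fixed value v determines
    it.\<close>
  let ?f = "\<lambda>((d, c), (d', c')). ((c, \<rho> d + \<rho> d'), (d, d'))"
  have "card ?S \<le> card (SIGMA x:I. T (snd x))"
  proof (rule card_inj_on_le[where f = ?f])
    show "inj_on ?f ?S" by (rule inj_onI) (use p in auto)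
    show "finite (SIGMA x:I. T (snd x))" using finI finT by auto
    show "?f ` ?S \<subseteq> (SIGMA x:I. T (snd x))"
    proof (rule image_subsetI)
      fix q assume "q \<in> ?S"
      then obtain d c d' c' where q: "q = ((d, c), (d', c'))"
        and H: "d \<in> D" "d' \<in> D" "c \<in> {0..<s}" "c' \<in> {0..<s}" "Q d d'"
        and v: "v = (X d + p * (c + s * \<rho> d)) + (X d' + p * (c' + s * \<rho> d'))"
        by blast
      define r where "r = \<rho> d + \<rho> d'"
      define e where "e = (X d + X d') div p"
      have v': "v = (X d + X d') + p * (c + c' + s * r)" by (simp add: v r_def algebra_simps)
      have z: "z = e + (c + c' + s * r)" unfolding z_def v' e_def using p by (simp add: div_mult_self4)
      have "0 \<le> X d + X d'" "X d + X d' < 2 * p" using X[OF H(1)] X[OF H(2)] by linarith+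
      then have "e = 0 \<or> e = 1" unfolding e_def using p
        by (smt (verit) div_pos_pos_trivial div_pos_geq mult_2 pos_imp_zdiv_nonneg_iff)
      then have "(c, r) \<in> I"
      proof
        assume "e = 0"
        then have "(z - c) div s = r" using H z s by simp
        then show ?thesis using H unfolding I_def by auto
      next
        assume e: "e = 1"
        show ?thesis
        proof (cases "c' + 1 < s")
          case True
          moreover have "z - c = (c' + 1) + s * r" using z e by simp
          ultimately have "(z - c) div s = r" using H s by simp
          then show ?thesis using H unfolding I_def by auto
        next
          case False
          then have "c' = s - 1" using H by auto
          then have z': "z = c + s * (r + 1)" using z e by (simp add: algebra_simps)
          then have "z mod s = c" using H by simp
          moreover have "(z - 1 - c) div s = r"
          proof -
            have "z - 1 - c = (s - 1) + s * r" using z' by (simp add: algebra_simps)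
            show ?thesis unfolding \<open>z - 1 - c = (s - 1) + s * r\<close> using s by simp
          qed
          ultimately show ?thesis unfolding I_def by auto
        qed
      qed
      moreover have "(d, d') \<in> T r"
        using H unfolding T_def by (simp add: r_def v' cong_def)
      ultimately show "?f q \<in> (SIGMA x:I. T (snd x))"
        by (simp add: r_def q)
    qed
  qed
  also have "\<dots> = (\<Sum>x\<in>I. card (T (snd x)))" using finI finT by simp
  also have "\<dots> \<le> (\<Sum>x\<in>I. m)" by (intro sum_mono) (simp only: T_def bound)
  also have "\<dots> = card I * m" by simp
  also have "\<dots> \<le> (nat s + 1) * m" by (rule mult_right_mono[OF cardI]) simp
  finally show ?thesis .
next
  case True
  then have "?S = {}" by auto
  then show ?thesis by (simp only: card.empty le0)
qed

lemma digit_unique: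
  fixes p :: int
  assumes "x + p * y = x' + p * y'" "0 \<le> x" "x < p" "0 \<le> x'" "x' < p"
  shows "x = x' \<and> y = y'"
proof -
  have "(x + p * y) mod p = x" "(x' + p * y') mod p = x'" using assms(2-) by simp_all
  then have "x = x'" using assms(1) by metis
  then show ?thesis using assms by simp
qed

lemma digit_less:
  fixes p :: int
  assumes "0 \<le> x" "x < p" "0 \<le> y" "y < n"
  shows "0 \<le> x + p * y \<and> x + p * y < p * n"
proof -
  have "p * (y + 1) \<le> p * n" using assms by (intro mult_left_mono) auto
  then show ?thesis using assms by (auto simp: algebra_simps)
qed

text \<open>A point (X, Y) of the parabola of i becomes the integer with digits X, c', Y, c,
  \<open>fst i\<close>, from the lowest up, in the mixed radix p, s, p, s. Both auxiliary digits run
  over all values, so \<open>card_lift_pairs\<close> applies twice and costs the factor (s + 1)^2 in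
  the number of representations against s^2 in the cardinality.\<close>

lemma (in odd_prime) lifted_curves:
  assumes A: "finite A" and good: "good A w" and N: "\<And>i. i \<in> A \<Longrightarrow> fst i \<in> {0..<N}" and s: "0 < s"
    and m: "\<And>n. int (card {(i, j) \<in> A \<times> A. fst i + fst j = n}) + (\<Sum>k | k \<in> sumset A \<and> fst k = n. \<bar>chi_conv A w k\<bar>) \<le> int m"
  shows "\<exists>B. B \<subseteq> {1..(int p)\<^sup>2 * s\<^sup>2 * N} \<and> card B = card A * (p - 1) * (nat s)\<^sup>2 \<and> sidon ((nat s + 1)\<^sup>2 * m) B"
proof -
  \<comment> \<open>The value x = 0 is left out: all parabolas pass through the origin.\<close>
  define D where "D = A \<times> {1..<int p}"
  define X where "X = (\<lambda>(i, x). (lin w i * x) mod int p)"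
  define Y where "Y = (\<lambda>(i, x). (lin w i * x\<^sup>2) mod int p)"
  define v1 where "v1 = (\<lambda>(d, c). Y d + int p * (c + s * fst (fst d)))"
  define v2 where "v2 = (\<lambda>(d, c). X (fst d) + int p * (c + s * v1 d))"
  define E where "E = (D \<times> {0..<s}) \<times> {0..<s}"
  have finD: "finite D" using A by (simp add: D_def)
  have XR: "0 \<le> X d \<and> X d < int p" and YR: "0 \<le> Y d \<and> Y d < int p" for d
    using gt2 by (simp_all add: X_def Y_def case_prod_unfold)
  have 0: "card {(d, d'). d \<in> D \<and> d' \<in> D \<and> [X d + X d' = a] (mod int p) \<and> [Y d + Y d' = b] (mod int p)
      \<and> fst (fst d) + fst (fst d') = n} \<le> m" (is "card ?S \<le> m") for a b n
  proof -
    let ?T = "{((i, x), (j, y)). i \<in> A \<and> j \<in> A \<and> x \<in> R \<and> y \<in> R \<and> fst i + fst j = n \<and>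
        [lin w i * x + lin w j * y = a] (mod int p) \<and> [lin w i * x\<^sup>2 + lin w j * y\<^sup>2 = b] (mod int p)}"
    have "?S \<subseteq> ?T" by (auto simp: D_def X_def Y_def cong_def mod_simps)
    moreover have "finite ?T" by (rule finite_subset[of _ "(A \<times> R) \<times> (A \<times> R)"]) (use A in auto)
    ultimately have "card ?S \<le> card ?T" by (rule card_mono[rotated])
    moreover have "int (card ?T) \<le> int m" using card_curve_sums[OF A good] m by (rule order_trans)
    ultimately show ?thesis by simp
  qed
  \<comment> \<open>The first lift treats Y. The congruence for X travels along in the place of
    \<open>Q\<close> and is used up by the second lift, where \<open>Q\<close> is
    \<open>True\<close>.\<close>
  have 1: "card {(d, d'). d \<in> D \<times> {0..<s} \<and> d' \<in> D \<times> {0..<s} \<and> True \<and>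
      [X (fst d) + X (fst d') = a] (mod int p) \<and> v1 d + v1 d' = r} \<le> (nat s + 1) * m" for a r
  proof -
    have "card {((d, c), (d', c')). d \<in> D \<and> d' \<in> D \<and> c \<in> {0..<s} \<and> c' \<in> {0..<s} \<and> [X d + X d' = a] (mod int p) \<and>
       (Y d + int p * (c + s * fst (fst d))) + (Y d' + int p * (c' + s * fst (fst d'))) = r} \<le> (nat s + 1) * m"
      by (rule card_lift_pairs[OF finD YR s 0])
    also have "{((d, c), (d', c')). d \<in> D \<and> d' \<in> D \<and> c \<in> {0..<s} \<and> c' \<in> {0..<s} \<and> [X d + X d' = a] (mod int p) \<and>
       (Y d + int p * (c + s * fst (fst d))) + (Y d' + int p * (c' + s * fst (fst d'))) = r}
      = {(d, d'). d \<in> D \<times> {0..<s} \<and> d' \<in> D \<times> {0..<s} \<and> True \<and>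
      [X (fst d) + X (fst d') = a] (mod int p) \<and> v1 d + v1 d' = r}"
      by (auto simp: v1_def)
    finally show ?thesis .
  qed
  have 2: "card {(d, d'). d \<in> E \<and> d' \<in> E \<and> v2 d + v2 d' = v} \<le> (nat s + 1) * ((nat s + 1) * m)" for v
  proof -
    have "card {((d, c), (d', c')). d \<in> D \<times> {0..<s} \<and> d' \<in> D \<times> {0..<s} \<and> c \<in> {0..<s} \<and> c' \<in> {0..<s} \<and> True \<and>
       (X (fst d) + int p * (c + s * v1 d)) + (X (fst d') + int p * (c' + s * v1 d')) = v} \<le> (nat s + 1) * ((nat s + 1) * m)"
      by (rule card_lift_pairs[OF _ XR s 1]) (use finD in simp)
    also have "{((d, c), (d', c')). d \<in> D \<times> {0..<s} \<and> d' \<in> D \<times> {0..<s} \<and> c \<in> {0..<s} \<and> c' \<in> {0..<s} \<and> True \<and>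
       (X (fst d) + int p * (c + s * v1 d)) + (X (fst d') + int p * (c' + s * v1 d')) = v}
      = {(d, d'). d \<in> E \<and> d' \<in> E \<and> v2 d + v2 d' = v}"
      by (auto simp: v2_def E_def)
    finally show ?thesis .
  qed
  have finE: "finite E" using finD by (simp add: E_def)
  have inj_curve: "d = d'" if "d \<in> D" "d' \<in> D" "X d = X d'" "Y d = Y d'" "fst (fst d) = fst (fst d')" for d d'
  proof -
    obtain i x j y where d: "d = (i, x)" "d' = (j, y)" by (cases d, cases d')
    have ij: "i \<in> A" "j \<in> A" "x \<in> {1..<int p}" "y \<in> {1..<int p}" using that d by (auto simp: D_def)
    have u: "\<not> int p dvd lin w i" using good ij by (simp add: good_def)
    have x: "\<not> int p dvd x" using ij dvd_small[of x] by auto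
    have 1: "[lin w i * x = lin w j * y] (mod int p)" "[lin w i * x\<^sup>2 = lin w j * y\<^sup>2] (mod int p)"
      using that d by (auto simp: X_def Y_def cong_def)
    \<comment> \<open>For u x = v y and u x^2 = v y^2, multiplying the first relation by y gives u x
      y = u x^2, hence x = y and then u = v.\<close>
    have "[lin w i * x * y = lin w j * y * y] (mod int p)" by (intro cong_mult 1 cong_refl)
    then have "[lin w i * x * x = lin w i * x * y] (mod int p)"
      using 1(2) by (metis power2_eq_square mult.assoc cong_sym cong_trans)
    then have "int p dvd lin w i * x * (x - y)" by (simp add: cong_iff_dvd_diff algebra_simps)
    then have "int p dvd x - y" using u x prime_int by (simp add: prime_dvd_mult_iff)
    then have xy: "x = y" using ij dvd_small[of "x - y"] by auto
    then have "int p dvd (lin w i - lin w j) * x" using 1(1) by (simp add: cong_iff_dvd_diff algebra_simps)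
    then have "int p dvd lin w i - lin w j" using x prime_int by (simp add: prime_dvd_mult_iff)
    then have "snd i = snd j" using good ij by (auto simp: good_def)
    then show ?thesis using xy d that(5) by (simp add: prod_eq_iff)
  qed
  have inj1: "d = d'" if "d \<in> D \<times> {0..<s}" "d' \<in> D \<times> {0..<s}" "X (fst d) = X (fst d')" "v1 d = v1 d'" for d d'
  proof -
    have "Y (fst d) + int p * (snd d + s * fst (fst (fst d))) = Y (fst d') + int p * (snd d' + s * fst (fst (fst d')))"
      using that(4) by (simp add: v1_def case_prod_unfold)
    from digit_unique[OF this] have Y: "Y (fst d) = Y (fst d')"
      and "snd d + s * fst (fst (fst d)) = snd d' + s * fst (fst (fst d'))" using YR by auto
    from digit_unique[OF this(2)] have "snd d = snd d'" "fst (fst (fst d)) = fst (fst (fst d'))"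
      using that(1,2) by auto
    then show ?thesis using inj_curve[of "fst d" "fst d'"] Y that by (auto simp: prod_eq_iff)
  qed
  have inj2: "inj_on v2 E"
  proof (rule inj_onI)
    fix d d' assume d: "d \<in> E" "d' \<in> E" "v2 d = v2 d'"
    then have "X (fst (fst d)) + int p * (snd d + s * v1 (fst d)) = X (fst (fst d')) + int p * (snd d' + s * v1 (fst d'))"
      by (simp add: v2_def case_prod_unfold)
    from digit_unique[OF this] have X: "X (fst (fst d)) = X (fst (fst d'))"
      and "snd d + s * v1 (fst d) = snd d' + s * v1 (fst d')" using XR by auto
    from digit_unique[OF this(2)] have "snd d = snd d'" "v1 (fst d) = v1 (fst d')"
      using d(1,2) by (auto simp: E_def)
    then show "d = d'" using inj1[of "fst d" "fst d'"] X d by (auto simp: prod_eq_iff E_def)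
  qed
  have v1R: "0 \<le> v1 d \<and> v1 d < int p * (s * N)" if "d \<in> D \<times> {0..<s}" for d
    unfolding v1_def case_prod_unfold
    by (intro digit_less conjunct1[OF digit_less[of _ _ _ N]] conjunct2[OF digit_less[of _ _ _ N]])
       (use that YR N in \<open>auto simp: D_def\<close>)
  have v2R: "0 \<le> v2 d \<and> v2 d < int p * (s * (int p * (s * N)))" if "d \<in> E" for d
    unfolding v2_def case_prod_unfold
    by (intro digit_less conjunct1[OF digit_less[of _ _ _ "int p * (s * N)"]] conjunct2[OF digit_less[of _ _ _ "int p * (s * N)"]])
       (use that XR v1R[of "fst d"] in \<open>auto simp: E_def\<close>)
  \<comment> \<open>The encoding starts at 0, so it is shifted by 1 into the required interval; sums
    of pairs shift by 2.\<close>
  define B where "B = (\<lambda>d. v2 d + 1) ` E"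
  have "B \<subseteq> {1..(int p)\<^sup>2 * s\<^sup>2 * N}"
    using v2R unfolding B_def by (fastforce simp: power2_eq_square mult_ac)
  moreover have "card B = card A * (p - 1) * (nat s)\<^sup>2"
  proof -
    have "card B = card E" unfolding B_def using inj2 by (intro card_image) (auto simp: inj_on_def)
    also have "\<dots> = card A * (p - 1) * (nat s)\<^sup>2"
    proof -
      have "nat (int p - 1) = p - 1" using gt2 by simp
      then show ?thesis by (simp add: E_def D_def card_cartesian_product power2_eq_square mult.assoc)
    qed
    finally show ?thesis .
  qed
  moreover have "sidon ((nat s + 1)\<^sup>2 * m) B"
    unfolding sidon_def
  proof (intro allI conjI)
    fix x
    let ?S = "{(d, d'). d \<in> E \<and> d' \<in> E \<and> v2 d + v2 d' = x - 2}"
    have sub: "rep_pairs B x \<subseteq> (\<lambda>(d, d'). (v2 d + 1, v2 d' + 1)) ` ?S"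
      by (auto simp: rep_pairs_def B_def image_iff)
    have fin: "finite ?S" by (rule finite_subset[of _ "E \<times> E"]) (use finE in auto)
    show "finite (rep_pairs B x)" using sub fin by (meson finite_imageI finite_subset)
    have "rep B x \<le> card ((\<lambda>(d, d'). (v2 d + 1, v2 d' + 1)) ` ?S)"
      unfolding rep_def using sub fin by (intro card_mono) auto
    also have "\<dots> \<le> card ?S" using fin by (rule card_image_le)
    also have "\<dots> \<le> (nat s + 1)\<^sup>2 * m" using 2[of "x - 2"] by (simp only: power2_eq_square mult.assoc)
    finally show "rep B x \<le> (nat s + 1)\<^sup>2 * m" .
  qed
  ultimately show ?thesis by blast
qed

section \<open>The parameter grid with prescribed weights\<close>

definition layer :: "nat \<Rightarrow> (nat \<Rightarrow> nat) \<Rightarrow> nat \<Rightarrow> (int \<times> int \<times> int) set" where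
  "layer M \<phi> i = {int i} \<times> {0..<int M} \<times> {0..<int (M * \<phi> i)}"

definition grid :: "nat \<Rightarrow> (nat \<Rightarrow> nat) \<Rightarrow> nat \<Rightarrow> (int \<times> int \<times> int) set" where
  "grid M \<phi> N = (\<Union>i<N. layer M \<phi> i)"

lemma card_layer: "card (layer M \<phi> i) = M\<^sup>2 * \<phi> i"
  by (simp add: layer_def card_cartesian_product power2_eq_square del: of_nat_mult)

lemma finite_grid: "finite (grid M \<phi> N)"
  by (simp add: grid_def layer_def)

lemma card_grid: "card (grid M \<phi> N) = M\<^sup>2 * (\<Sum>i<N. \<phi> i)"
proof -
  have "card (grid M \<phi> N) = (\<Sum>i<N. card (layer M \<phi> i))"
    unfolding grid_def by (rule card_UN_disjoint) (auto simp: layer_def)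
  then show ?thesis by (simp add: card_layer sum_distrib_left)
qed

lemma gridD:
  assumes "i \<in> grid M \<phi> N" "\<And>i. \<phi> i \<le> F"
  shows "fst i \<in> {0..<int N}" "fst (snd i) \<in> {0..<int M}" "snd (snd i) \<in> {0..<int (M * F)}"
proof -
  obtain k where k: "k < N" "i \<in> layer M \<phi> k" using assms(1) by (auto simp: grid_def)
  then show "fst i \<in> {0..<int N}" "fst (snd i) \<in> {0..<int M}" by (auto simp: layer_def)
  have "M * \<phi> k \<le> M * F" using assms(2) by simp
  then have "int (M * \<phi> k) \<le> int (M * F)" by (simp only: of_nat_le_iff)
  moreover have "snd (snd i) \<in> {0..<int (M * \<phi> k)}" using k(2) unfolding layer_def by (auto simp del: of_nat_mult)
  ultimately show "snd (snd i) \<in> {0..<int (M * F)}"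
    unfolding atLeastLessThan_iff by (blast intro: order.strict_trans2)
qed

text \<open>Only layers whose positions add up to n contribute, each pair of layers M^4 \<phi> i
  \<phi> j pairs of points. For negative n the left-hand set is empty, so the value
  \<open>nat n\<close> = 0 is harmless.\<close>

lemma card_grid_pairs:
  "card {(i, j) \<in> grid M \<phi> N \<times> grid M \<phi> N. fst i + fst j = n}
     \<le> M ^ 4 * (\<Sum>(i, j) | (i, j) \<in> {..<N} \<times> {..<N} \<and> i + j = nat n. \<phi> i * \<phi> j)"
proof -
  let ?P = "{(i, j). (i, j) \<in> {..<N} \<times> {..<N} \<and> i + j = nat n}"
  have fin: "finite ?P" by (rule finite_subset[of _ "{..<N} \<times> {..<N}"]) auto
  have "card {(i, j) \<in> grid M \<phi> N \<times> grid M \<phi> N. fst i + fst j = n}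
      \<le> card (\<Union>x\<in>?P. layer M \<phi> (fst x) \<times> layer M \<phi> (snd x))"
    using fin by (intro card_mono finite_UN_I) (force simp: grid_def layer_def)+
  also have "\<dots> \<le> (\<Sum>x\<in>?P. card (layer M \<phi> (fst x) \<times> layer M \<phi> (snd x)))"
    by (rule card_UN_le[OF fin])
  also have "\<dots> = (\<Sum>(i, j)\<in>?P. M ^ 4 * (\<phi> i * \<phi> j))"
    by (simp add: card_cartesian_product card_layer case_prod_unfold power2_eq_square power4_eq_xxxx mult_ac)
  also have "\<dots> = M ^ 4 * (\<Sum>(i, j)\<in>?P. \<phi> i * \<phi> j)"
    by (simp add: sum_distrib_left case_prod_unfold)
  finally show ?thesis .
qed

text \<open>If i and j share the coordinate a, then given i there are at most N M F choices for j,
  and k is free. Otherwise the line through i and j determines b of k from its a, leaving at most N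
  M choices for k.\<close>

lemma (in odd_prime) card_grid_degenerate:
  fixes M N :: nat
  assumes F: "\<And>i. \<phi> i \<le> F" "F \<ge> 1"
  defines "A \<equiv> grid M \<phi> N"
  shows "card {(i, j, k). i \<in> A \<and> j \<in> A \<and> k \<in> A \<and> cross i j k = 0} \<le> 2 * (card A)\<^sup>2 * N * M * F"
proof -
  let ?S1 = "{(i, j, k). i \<in> A \<and> j \<in> A \<and> k \<in> A \<and> fst (snd j) = fst (snd i)}"
  let ?S2 = "{(i, j, k). i \<in> A \<and> j \<in> A \<and> k \<in> A \<and> fst (snd j) \<noteq> fst (snd i) \<and> cross i j k = 0}"
  have fA: "finite A" unfolding A_def by (rule finite_grid)
  have fin: "finite ?S1" "finite ?S2"
    by (rule finite_subset[of _ "A \<times> A \<times> A"]; use fA in auto)+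
  note bd = gridD[where \<phi> = \<phi> and M = M and N = N, OF _ F(1), folded A_def]
  have "card ?S1 \<le> card (A \<times> A \<times> {0..<int N} \<times> {0..<int (M * F)})"
  proof (rule card_inj_on_le[where f = "\<lambda>(i, j, k). (i, k, fst j, snd (snd j))"])
    show "inj_on (\<lambda>(i, j, k). (i, k, fst j, snd (snd j))) ?S1"
      by (rule inj_onI) (auto simp: prod_eq_iff)
    show "(\<lambda>(i, j, k). (i, k, fst j, snd (snd j))) ` ?S1 \<subseteq> A \<times> A \<times> {0..<int N} \<times> {0..<int (M * F)}"
    proof (rule image_subsetI)
      fix q assume "q \<in> ?S1"
      then obtain i j k where q: "q = (i, j, k)" "i \<in> A" "j \<in> A" "k \<in> A" by blast
      show "(\<lambda>(i, j, k). (i, k, fst j, snd (snd j))) q \<in> A \<times> A \<times> {0..<int N} \<times> {0..<int (M * F)}"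
        unfolding q(1) prod.case by (intro SigmaI q bd)
    qed
  qed (use fA in simp)
  also have "\<dots> = (card A)\<^sup>2 * N * M * F" by (simp add: card_cartesian_product power2_eq_square del: of_nat_mult)
  finally have 1: "card ?S1 \<le> (card A)\<^sup>2 * N * M * F" .
  have "card ?S2 \<le> card (A \<times> A \<times> {0..<int N} \<times> {0..<int M})"
  proof (rule card_inj_on_le[where f = "\<lambda>(i, j, k). (i, j, fst k, fst (snd k))"])
    show "inj_on (\<lambda>(i, j, k). (i, j, fst k, fst (snd k))) ?S2"
    proof (rule inj_onI)
      fix q q' assume "q \<in> ?S2" "q' \<in> ?S2"
        and eq: "(\<lambda>(i, j, k). (i, j, fst k, fst (snd k))) q = (\<lambda>(i, j, k). (i, j, fst k, fst (snd k))) q'"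
      then obtain i j k k' where q: "q = (i, j, k)" "q' = (i, j, k')" "fst (snd j) \<noteq> fst (snd i)"
        "cross i j k = 0" "cross i j k' = 0" by auto
      have k: "fst k = fst k'" "fst (snd k) = fst (snd k')" using eq q by auto
      have "(fst (snd j) - fst (snd i)) * (snd (snd k) - snd (snd k')) = cross i j k - cross i j k'"
        unfolding cross_def k by (simp add: algebra_simps)
      then have "snd (snd k) = snd (snd k')" using q by simp
      then show "q = q'" using k q by (simp add: prod_eq_iff)
    qed
    show "(\<lambda>(i, j, k). (i, j, fst k, fst (snd k))) ` ?S2 \<subseteq> A \<times> A \<times> {0..<int N} \<times> {0..<int M}"
    proof (rule image_subsetI)
      fix q assume "q \<in> ?S2"
      then obtain i j k where q: "q = (i, j, k)" "i \<in> A" "j \<in> A" "k \<in> A" by blast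
      show "(\<lambda>(i, j, k). (i, j, fst k, fst (snd k))) q \<in> A \<times> A \<times> {0..<int N} \<times> {0..<int M}"
        unfolding q(1) prod.case by (intro SigmaI q bd)
    qed
  qed (use fA in simp)
  also have "\<dots> = (card A)\<^sup>2 * N * M" by (simp add: card_cartesian_product power2_eq_square)
  also have "\<dots> \<le> (card A)\<^sup>2 * N * M * F" using F(2) by simp
  finally have 2: "card ?S2 \<le> (card A)\<^sup>2 * N * M * F" .
  have "card {(i, j, k). i \<in> A \<and> j \<in> A \<and> k \<in> A \<and> cross i j k = 0} \<le> card (?S1 \<union> ?S2)"
    using fin by (intro card_mono) auto
  also have "\<dots> \<le> card ?S1 + card ?S2" by (rule card_Un_le)
  finally show ?thesis using 1 2 by linarith
qed

text \<open>Cauchy-Schwarz on one level of the sumset, which has at most 4 M^2 F elements, against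
  the second moment, of order M^5 by the count of collinear triples. The squared error is of order
  M^7, so for large M the error M^(7/2) is negligible next to the main term of order M^4.\<close>

lemma (in odd_prime) grid_character_sum:
  assumes F: "\<And>i. \<phi> i \<le> F" "F \<ge> 1" and M: "M \<ge> 1" and N: "N \<ge> 1"
    and p: "2 * (M * F)\<^sup>2 \<le> p" "6 * (M\<^sup>2 * N * F) ^ 3 \<le> p"
  defines "A \<equiv> grid M \<phi> N"
  shows "\<exists>w. good A w \<and> (\<forall>n. (\<Sum>k | k \<in> sumset A \<and> fst k = n. \<bar>chi_conv A w k\<bar>)\<^sup>2 \<le> int (24 * N ^ 3 * F ^ 4 * M ^ 7))"
proof -
  note bd = gridD[where \<phi> = \<phi> and M = M and N = N, OF _ F(1), folded A_def]
  have fA: "finite A" unfolding A_def by (rule finite_grid)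
  have "(\<Sum>i<N. \<phi> i) \<le> (\<Sum>i<N. F)" by (intro sum_mono F)
  then have K: "card A \<le> M\<^sup>2 * N * F" unfolding A_def card_grid by simp
  let ?D = "2 * N ^ 3 * F ^ 3 * M ^ 5"
  have MF: "M \<le> M * F" using F(2) by simp
  have "\<exists>w. good A w \<and> (\<Sum>k\<in>sumset A. (chi_conv A w k)\<^sup>2) \<le> 2 * int (?D + 1)"
  proof (rule good_exists[OF fA])
    show "snd i \<in> {0..<int (M * F)} \<times> {0..<int (M * F)}" if "i \<in> A" for i
    proof -
      have "int M \<le> int (M * F)" using MF by (simp only: of_nat_le_iff)
      then have "{0..<int M} \<subseteq> {0..<int (M * F)}" by (intro ivl_subset[THEN iffD2]) blast
      then have "fst (snd i) \<in> {0..<int (M * F)}" using bd(2)[OF that] by blast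
      then show ?thesis using bd(3)[OF that] by (simp only: mem_Times_iff simp_thms)
    qed
    have "int (2 * (M * F)\<^sup>2) \<le> int p" using p(1) by (simp only: of_nat_le_iff)
    then show "2 * (int (M * F))\<^sup>2 \<le> int p" by simp
    have "(card A) ^ 3 \<le> (M\<^sup>2 * N * F) ^ 3" by (intro power_mono K) simp
    then show "6 * card A ^ 3 \<le> p" using p(2) by linarith
    have "card {(i, j, k). i \<in> A \<and> j \<in> A \<and> k \<in> A \<and> cross i j k = 0} \<le> 2 * (card A)\<^sup>2 * N * M * F"
      unfolding A_def by (rule card_grid_degenerate[OF F])
    also have "\<dots> \<le> 2 * (M\<^sup>2 * N * F)\<^sup>2 * N * M * F"
      by (intro mult_right_mono mult_left_mono power_mono K) auto
    also have "\<dots> = ?D" by (simp add: power_mult_distrib eval_nat_numeral mult_ac)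
    finally show "card {(i, j, k). i \<in> A \<and> j \<in> A \<and> k \<in> A \<and> cross i j k = 0} \<le> ?D" .
  qed
  then obtain w where w: "good A w" "(\<Sum>k\<in>sumset A. (chi_conv A w k)\<^sup>2) \<le> 2 * int (?D + 1)" by blast
  have "(\<Sum>k | k \<in> sumset A \<and> fst k = n. \<bar>chi_conv A w k\<bar>)\<^sup>2 \<le> int (24 * N ^ 3 * F ^ 4 * M ^ 7)" for n
  proof -
    let ?L = "{k. k \<in> sumset A \<and> fst k = n}"
    have fL: "finite ?L" by (rule finite_subset[of _ "sumset A"]) (use fA in auto)
    have "card ?L \<le> card ({0..<2 * int M} \<times> {0..<2 * int (M * F)})"
    proof (rule card_inj_on_le[where f = snd])
      show "inj_on snd ?L" by (rule inj_onI) (simp add: prod_eq_iff)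
      show "snd ` ?L \<subseteq> {0..<2 * int M} \<times> {0..<2 * int (M * F)}"
      proof (rule image_subsetI)
        fix k assume "k \<in> ?L"
        then obtain i j where ij: "i \<in> A" "j \<in> A" and k: "k = i + j" by force
        show "snd k \<in> {0..<2 * int M} \<times> {0..<2 * int (M * F)}"
          using bd(2,3)[OF ij(1)] bd(2,3)[OF ij(2)] unfolding k by (simp add: mem_Times_iff del: of_nat_mult)
      qed
    qed simp
    also have "\<dots> = 4 * M\<^sup>2 * F"
      by (simp add: card_cartesian_product power2_eq_square nat_mult_distrib)
    finally have cL: "int (card ?L) \<le> int (4 * M\<^sup>2 * F)" by (simp only: of_nat_le_iff)
    have "(\<Sum>k\<in>?L. \<bar>chi_conv A w k\<bar>)\<^sup>2 \<le> (\<Sum>k\<in>?L. (chi_conv A w k)\<^sup>2) * int (card ?L)"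
    proof -
      have "(\<Sum>k\<in>?L. real_of_int \<bar>chi_conv A w k\<bar>)\<^sup>2 \<le> (\<Sum>k\<in>?L. (real_of_int \<bar>chi_conv A w k\<bar>)\<^sup>2) * real (card ?L)"
        by (rule sum_squared_le_sum_of_squares)
      then have "real_of_int ((\<Sum>k\<in>?L. \<bar>chi_conv A w k\<bar>)\<^sup>2) \<le> real_of_int ((\<Sum>k\<in>?L. (chi_conv A w k)\<^sup>2) * int (card ?L))"
        by simp
      then show ?thesis by (simp only: of_int_le_iff)
    qed
    also have "\<dots> \<le> 2 * int (?D + 1) * int (4 * M\<^sup>2 * F)"
    proof (intro mult_mono cL)
      have "(\<Sum>k\<in>?L. (chi_conv A w k)\<^sup>2) \<le> (\<Sum>k\<in>sumset A. (chi_conv A w k)\<^sup>2)"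
        using fA by (intro sum_mono2) auto
      then show "(\<Sum>k\<in>?L. (chi_conv A w k)\<^sup>2) \<le> 2 * int (?D + 1)" using w(2) by linarith
    qed auto
    also have "\<dots> = int (2 * (?D + 1) * (4 * M\<^sup>2 * F))" by (simp only: of_nat_mult of_nat_numeral)
    also have "\<dots> \<le> int (24 * N ^ 3 * F ^ 4 * M ^ 7)"
    proof -
      have "1 \<le> N ^ 3 * F ^ 3 * M ^ 5" using F(2) M N by simp
      then have "2 * (?D + 1) * (4 * M\<^sup>2 * F) \<le> 2 * (3 * (N ^ 3 * F ^ 3 * M ^ 5)) * (4 * M\<^sup>2 * F)"
        by (intro mult_right_mono mult_left_mono) auto
      also have "\<dots> = 24 * N ^ 3 * (F ^ 3 * F ^ 1) * (M ^ 5 * M\<^sup>2)" by simp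
      also have "\<dots> = 24 * N ^ 3 * F ^ 4 * M ^ 7" unfolding power_add[symmetric] by simp
      finally show ?thesis by (simp only: of_nat_le_iff)
    qed
    finally show ?thesis .
  qed
  with w(1) show ?thesis by blast
qed

lemma sidon_mono: "sidon g A \<Longrightarrow> g \<le> g' \<Longrightarrow> sidon g' A"
  by (auto simp: sidon_def intro: order_trans)

text \<open>The main term is at most M^4 h, and the character error is at most \<delta> h M^4 once M
  is large. The threshold for p depends on M but not on s or g, which leaves s and g free when the
  parameters are fitted to n.\<close>

lemma sidon_from_weights:
  fixes \<phi> :: "nat \<Rightarrow> nat" and h \<delta> :: real
  assumes F: "\<And>i. \<phi> i \<le> F" and N: "N \<ge> 1" and h: "h > 0" and \<delta>: "\<delta> > 0"
    and conv: "\<And>n. real (\<Sum>(i, j) | (i, j) \<in> {..<N} \<times> {..<N} \<and> i + j = n. \<phi> i * \<phi> j) \<le> h"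
  shows "\<exists>M0. \<forall>M\<ge>M0. \<exists>P0. \<forall>p\<ge>P0. \<forall>s g. prime p \<longrightarrow> s > 0 \<longrightarrow>
    real ((s + 1)\<^sup>2) * (real M ^ 4 * h * (1 + \<delta>)) \<le> real g \<longrightarrow>
    (\<exists>B. B \<subseteq> {1..int (p\<^sup>2 * s\<^sup>2 * N)} \<and> card B = M\<^sup>2 * (\<Sum>i<N. \<phi> i) * (p - 1) * s\<^sup>2 \<and> sidon g B)"
proof -
  define G where "G = Suc F"
  have G: "\<phi> i \<le> G" "G \<ge> 1" for i using F[of i] by (auto simp: G_def)
  \<comment> \<open>Makes 24 N^3 G^4 M^7 at most (\<delta> h M^4)^2.\<close>
  define M0 where "M0 = nat \<lceil>real (24 * N ^ 3 * G ^ 4) / (\<delta> * h)\<^sup>2\<rceil> + 1"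
  show ?thesis
  proof (rule exI[of _ M0], intro allI impI)
    fix M assume M: "M \<ge> M0"
    show "\<exists>P0. \<forall>p\<ge>P0. \<forall>s g. prime p \<longrightarrow> s > 0 \<longrightarrow>
      real ((s + 1)\<^sup>2) * (real M ^ 4 * h * (1 + \<delta>)) \<le> real g \<longrightarrow>
      (\<exists>B. B \<subseteq> {1..int (p\<^sup>2 * s\<^sup>2 * N)} \<and> card B = M\<^sup>2 * (\<Sum>i<N. \<phi> i) * (p - 1) * s\<^sup>2 \<and> sidon g B)"
    proof (rule exI[of _ "2 * (M * G)\<^sup>2 + 6 * (M\<^sup>2 * N * G) ^ 3 + 3"], intro allI impI)
      fix p s g :: nat
      assume p: "2 * (M * G)\<^sup>2 + 6 * (M\<^sup>2 * N * G) ^ 3 + 3 \<le> p" "prime p" and s: "s > 0"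
        and g: "real ((s + 1)\<^sup>2) * (real M ^ 4 * h * (1 + \<delta>)) \<le> real g"
      interpret odd_prime p using p by unfold_locales auto
      have M1: "M \<ge> 1" using M by (simp add: M0_def)
      define A where "A = grid M \<phi> N"
      obtain w where w: "good A w"
        "\<And>n. (\<Sum>k | k \<in> sumset A \<and> fst k = n. \<bar>chi_conv A w k\<bar>)\<^sup>2 \<le> int (24 * N ^ 3 * G ^ 4 * M ^ 7)"
        using grid_character_sum[where \<phi> = \<phi>, OF G M1 N] p(1) unfolding A_def by auto
      define m where "m = nat \<lfloor>real M ^ 4 * h * (1 + \<delta>)\<rfloor>"
      have err: "real_of_int (\<Sum>k | k \<in> sumset A \<and> fst k = n. \<bar>chi_conv A w k\<bar>) \<le> real M ^ 4 * h * \<delta>" (is "real_of_int ?E \<le> _") for n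
      proof (rule power2_le_imp_le)
        have "real (24 * N ^ 3 * G ^ 4) / (\<delta> * h)\<^sup>2 \<le> real M" using M unfolding M0_def by linarith
        then have le: "real (24 * N ^ 3 * G ^ 4) \<le> real M * (\<delta> * h)\<^sup>2"
          using h \<delta> by (simp add: pos_divide_le_eq)
        have "(real_of_int ?E)\<^sup>2 = real_of_int (?E\<^sup>2)" by simp
        also have "\<dots> \<le> real_of_int (int (24 * N ^ 3 * G ^ 4 * M ^ 7))"
          by (simp only: of_int_le_iff w(2))
        also have "\<dots> = real (24 * N ^ 3 * G ^ 4) * real M ^ 7" by simp
        also have "\<dots> \<le> (real M * (\<delta> * h)\<^sup>2) * real M ^ 7" by (intro mult_right_mono le) simp
        also have "\<dots> = (real M ^ 4 * h * \<delta>)\<^sup>2" by (simp add: power2_eq_square eval_nat_numeral mult_ac)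
        finally show "(real_of_int ?E)\<^sup>2 \<le> (real M ^ 4 * h * \<delta>)\<^sup>2" .
      qed (use h \<delta> in simp)
      have mm: "int (card {(i, j) \<in> A \<times> A. fst i + fst j = n}) + (\<Sum>k | k \<in> sumset A \<and> fst k = n. \<bar>chi_conv A w k\<bar>) \<le> int m" for n
      proof -
        have "real (card {(i, j) \<in> A \<times> A. fst i + fst j = n})
           \<le> real (M ^ 4 * (\<Sum>(i, j) | (i, j) \<in> {..<N} \<times> {..<N} \<and> i + j = nat n. \<phi> i * \<phi> j))"
          unfolding A_def by (simp only: of_nat_le_iff card_grid_pairs)
        also have "\<dots> = real M ^ 4 * real (\<Sum>(i, j) | (i, j) \<in> {..<N} \<times> {..<N} \<and> i + j = nat n. \<phi> i * \<phi> j)"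
          by (simp only: of_nat_mult of_nat_power)
        also have "\<dots> \<le> real M ^ 4 * h" by (intro mult_left_mono conv) simp
        finally have "real_of_int (int (card {(i, j) \<in> A \<times> A. fst i + fst j = n}) + (\<Sum>k | k \<in> sumset A \<and> fst k = n. \<bar>chi_conv A w k\<bar>))
            \<le> real M ^ 4 * h * (1 + \<delta>)"
          using err[of n] by (simp add: distrib_left)
        then have "int (card {(i, j) \<in> A \<times> A. fst i + fst j = n}) + (\<Sum>k | k \<in> sumset A \<and> fst k = n. \<bar>chi_conv A w k\<bar>)
            \<le> \<lfloor>real M ^ 4 * h * (1 + \<delta>)\<rfloor>" by (simp only: le_floor_iff)
        also have "\<dots> \<le> int m" unfolding m_def by simp
        finally show ?thesis .
      qed
      have "\<exists>B. B \<subseteq> {1..(int p)\<^sup>2 * (int s)\<^sup>2 * int N} \<and> card B = card A * (p - 1) * (nat (int s))\<^sup>2 \<and> sidon ((nat (int s) + 1)\<^sup>2 * m) B"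
      proof (rule lifted_curves[OF _ w(1) _ _ mm])
        show "finite A" unfolding A_def by (rule finite_grid)
        show "fst i \<in> {0..<int N}" if "i \<in> A" for i
          using gridD(1)[where \<phi> = \<phi>, OF that[unfolded A_def] G(1)] .
      qed (use s in simp)
      then obtain B where B: "B \<subseteq> {1..(int p)\<^sup>2 * (int s)\<^sup>2 * int N}" "card B = card A * (p - 1) * s\<^sup>2" "sidon ((s + 1)\<^sup>2 * m) B"
        by auto
      have "real ((s + 1)\<^sup>2 * m) \<le> real ((s + 1)\<^sup>2) * (real M ^ 4 * h * (1 + \<delta>))"
        unfolding of_nat_mult m_def using h \<delta> by (intro mult_left_mono of_nat_floor) auto
      then have "real ((s + 1)\<^sup>2 * m) \<le> real g" using g by (rule order_trans)
      then have "(s + 1)\<^sup>2 * m \<le> g" by (simp only: of_nat_le_iff)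
      then have "sidon g B" using B(3) sidon_mono by blast
      then show "\<exists>B. B \<subseteq> {1..int (p\<^sup>2 * s\<^sup>2 * N)} \<and> card B = M\<^sup>2 * (\<Sum>i<N. \<phi> i) * (p - 1) * s\<^sup>2 \<and> sidon g B"
        using B(1,2) by (intro exI[of _ B]) (simp add: A_def card_grid)
    qed
  qed
qed

section \<open>Discretising an admissible function\<close>

text \<open>Provides a Borel function for the Fubini arguments. The bound on the autoconvolution
  survives at every x because t -> x - t preserves null sets.\<close>

lemma admissible_borel_version:
  assumes "admissible f"
  shows "\<exists>h :: real \<Rightarrow> ennreal. h \<in> borel_measurable borel \<and> (\<forall>x. x \<notin> {0..1} \<longrightarrow> h x = 0) \<and>
    (\<integral>\<^sup>+t. h t \<partial>lborel) = ennreal (LINT t:{0..1}|lebesgue. f t) \<and>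
    (\<forall>x. (\<integral>\<^sup>+t. h t * h (x - t) \<partial>lborel) \<le> 1)"
proof -
  have nn: "0 \<le> f x" and out: "x \<notin> {0..1} \<Longrightarrow> f x = 0"
    and int: "set_integrable lebesgue {0..1} f"
    and conv: "(\<integral>\<^sup>+t\<in>{0..1}. ennreal (f t * f (x - t)) \<partial>lebesgue) \<le> 1" for x
    using assms by (auto simp: admissible_def)
  have ind: "(\<lambda>t. indicator {0..1} t *\<^sub>R f t) = f"
    by (rule ext) (use out in \<open>auto simp: indicator_def\<close>)
  have fi: "integrable lebesgue f" using int unfolding set_integrable_def ind .
  then have "f \<in> borel_measurable (completion lborel)" by simp
  from completion_ex_borel_measurable_real[OF this]
  obtain h0 where h0: "h0 \<in> borel_measurable lborel" "AE x in lborel. f x = h0 x" by auto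
  \<comment> \<open>The indicator makes the support condition hold everywhere, not only almost
    everywhere.\<close>
  define h where "h x = indicator {0..1} x * ennreal (h0 x)" for x
  have hm [measurable]: "h \<in> borel_measurable borel" unfolding h_def using h0(1) by simp
  have AEh: "AE x in lborel. ennreal (f x) = h x"
    using h0(2) by eventually_elim (use out in \<open>auto simp: h_def indicator_def\<close>)
  have AEr: "AE t in lborel. ennreal (f (x - t)) = h (x - t)" for x
  proof -
    have "distr lborel borel ((-) x) = lborel"
      using lborel_real_affine[of "-1" x] by (simp add: density_1)
    then have "AE t in distr lborel borel ((-) x). ennreal (f t) = h t" using AEh by (simp only:)
    then show ?thesis by (rule AE_distrD[rotated]) simp
  qed
  have "(\<integral>\<^sup>+t. h t * h (x - t) \<partial>lborel) \<le> 1" for x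
  proof -
    have "(\<integral>\<^sup>+t. h t * h (x - t) \<partial>lborel) = (\<integral>\<^sup>+t. h t * h (x - t) \<partial>lebesgue)"
      by (rule nn_integral_completion[symmetric])
    also have "\<dots> = (\<integral>\<^sup>+t\<in>{0..1}. ennreal (f t * f (x - t)) \<partial>lebesgue)"
    proof (rule nn_integral_cong_AE)
      have "AE t in lborel. h t * h (x - t) = ennreal (f t * f (x - t)) * indicator {0..1} t"
        using AEh AEr[of x]
        by eventually_elim (use out in \<open>auto simp: indicator_def ennreal_mult nn\<close>)
      then show "AE t in lebesgue. h t * h (x - t) = ennreal (f t * f (x - t)) * indicator {0..1} t"
        by (rule AE_completion)
    qed
    finally show ?thesis using conv by simp
  qed
  moreover have "(\<integral>\<^sup>+t. h t \<partial>lborel) = ennreal (LINT t:{0..1}|lebesgue. f t)"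
  proof -
    have "(\<integral>\<^sup>+t. h t \<partial>lborel) = (\<integral>\<^sup>+t. h t \<partial>lebesgue)"
      by (rule nn_integral_completion[symmetric])
    also have "\<dots> = (\<integral>\<^sup>+t. ennreal (f t) \<partial>lebesgue)"
      by (rule nn_integral_cong_AE) (use AE_completion[OF AEh] in \<open>eventually_elim, simp\<close>)
    also have "\<dots> = ennreal (integral\<^sup>L lebesgue f)"
      by (rule nn_integral_eq_integral[OF fi]) (simp add: nn)
    finally show ?thesis unfolding set_lebesgue_integral_def ind .
  qed
  moreover have "x \<notin> {0..1} \<Longrightarrow> h x = 0" for x by (simp add: h_def)
  ultimately show ?thesis using hm by (intro exI[of _ h]) blast
qed

lemma nn_integral2_sum:
  fixes F :: "'a \<Rightarrow> real \<Rightarrow> real \<Rightarrow> ennreal"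
  assumes [measurable]: "\<And>x. (\<lambda>(t, t'). F x t t') \<in> borel_measurable (lborel \<Otimes>\<^sub>M lborel)"
  shows "(\<integral>\<^sup>+t. (\<integral>\<^sup>+t'. (\<Sum>x\<in>X. F x t t') \<partial>lborel) \<partial>lborel) = (\<Sum>x\<in>X. \<integral>\<^sup>+t. (\<integral>\<^sup>+t'. F x t t' \<partial>lborel) \<partial>lborel)"
proof -
  have "(\<integral>\<^sup>+t'. (\<Sum>x\<in>X. F x t t') \<partial>lborel) = (\<Sum>x\<in>X. \<integral>\<^sup>+t'. F x t t' \<partial>lborel)" for t
    by (rule nn_integral_sum) measurable
  then show ?thesis by (simp add: nn_integral_sum)
qed

section \<open>Weights from overlapping windows\<close>

context
  fixes h :: "real \<Rightarrow> ennreal" and N L :: nat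
  assumes hm [measurable]: "h \<in> borel_measurable borel"
    and h_out: "\<And>x. x \<notin> {0..1} \<Longrightarrow> h x = 0"
    and h_conv: "\<And>x. (\<integral>\<^sup>+t. h t * h (x - t) \<partial>lborel) \<le> 1"
    and N: "N > 0"
begin

(* For t \<ge> 0, t lies in bin i iff (i - L + 1) / N \<le> t < (i + 1) / N; the windows overlap. *)
definition bin :: "nat \<Rightarrow> real set" where
  "bin i = {t. nat \<lfloor>real N * t\<rfloor> \<le> i \<and> i < nat \<lfloor>real N * t\<rfloor> + L}"

definition wt :: "nat \<Rightarrow> ennreal" where
  "wt i = (\<integral>\<^sup>+t. h t * indicator (bin i) t \<partial>lborel)"

lemma bin_sets [measurable]: "bin i \<in> sets borel"
  unfolding bin_def by measurable

lemma wt_le: "wt i \<le> (\<integral>\<^sup>+t. h t \<partial>lborel)"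
  unfolding wt_def by (intro nn_integral_mono) (simp add: indicator_def)

text \<open>Each t in [0, 1] lies in exactly L bins, with indices from floor (N t) to floor (N t) +
  L - 1, all below N + L.\<close>

lemma sum_wt: "(\<Sum>i<N + L. wt i) = of_nat L * (\<integral>\<^sup>+t. h t \<partial>lborel)"
proof -
  have "(\<Sum>i<N + L. wt i) = (\<integral>\<^sup>+t. (\<Sum>i<N + L. h t * indicator (bin i) t) \<partial>lborel)"
    unfolding wt_def by (rule nn_integral_sum[symmetric]) measurable
  also have "\<dots> = (\<integral>\<^sup>+t. of_nat L * h t \<partial>lborel)"
  proof (intro nn_integral_cong)
    fix t
    show "(\<Sum>i<N + L. h t * indicator (bin i) t) = of_nat L * h t"
    proof (cases "t \<in> {0..1}")
      case True
      let ?u = "nat \<lfloor>real N * t\<rfloor>"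
      have "real N * t \<le> real N * 1" using True by (intro mult_left_mono) auto
      then have "?u \<le> N" by (simp add: nat_le_iff floor_le_iff)
      then have "{i \<in> {..<N + L}. t \<in> bin i} = {?u..<?u + L}" by (auto simp: bin_def)
      then have "(\<Sum>i<N + L. indicator (bin i) t) = (of_nat L :: ennreal)"
        by (simp add: indicator_def sum.If_cases Int_def)
      then show ?thesis by (simp add: sum_distrib_left[symmetric] mult.commute)
    qed (simp add: h_out)
  qed
  also have "\<dots> = of_nat L * (\<integral>\<^sup>+t. h t \<partial>lborel)" by (rule nn_integral_cmult) measurable
  finally show ?thesis .
qed

text \<open>With x = t + t' as new variable, the double integral is that of the autoconvolution over
  [a, b), and the autoconvolution is at most 1 pointwise.\<close>

lemma window_le:
  assumes "a \<le> b"
  shows "(\<integral>\<^sup>+t. (\<integral>\<^sup>+t'. h t * h t' * indicator {a..<b} (t + t') \<partial>lborel) \<partial>lborel) \<le> ennreal (b - a)"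
proof -
  have "(\<integral>\<^sup>+t'. h t * h t' * indicator {a..<b} (t + t') \<partial>lborel)
      = (\<integral>\<^sup>+x. h t * h (x - t) * indicator {a..<b} x \<partial>lborel)" for t
    using nn_integral_real_affine[of "\<lambda>t'. h t * h t' * indicator {a..<b} (t + t')" 1 "- t"] by simp
  then have "(\<integral>\<^sup>+t. (\<integral>\<^sup>+t'. h t * h t' * indicator {a..<b} (t + t') \<partial>lborel) \<partial>lborel)
      = (\<integral>\<^sup>+t. (\<integral>\<^sup>+x. h t * h (x - t) * indicator {a..<b} x \<partial>lborel) \<partial>lborel)" by simp
  also have "\<dots> = (\<integral>\<^sup>+x. (\<integral>\<^sup>+t. h t * h (x - t) * indicator {a..<b} x \<partial>lborel) \<partial>lborel)"
    by (rule lborel_pair.Fubini') simp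
  also have "\<dots> = (\<integral>\<^sup>+x. (\<integral>\<^sup>+t. h t * h (x - t) \<partial>lborel) * indicator {a..<b} x \<partial>lborel)"
    by (intro nn_integral_cong nn_integral_multc) measurable
  also have "\<dots> \<le> (\<integral>\<^sup>+x. 1 * indicator {a..<b} x \<partial>lborel)"
    by (intro nn_integral_mono mult_right_mono h_conv) simp
  also have "\<dots> = ennreal (b - a)" using assms by simp
  finally show ?thesis .
qed

text \<open>For fixed t and t', a pair (i, j) with sum n is determined by l = i - floor (N t), one
  of L values, and each l confines t + t' to a window of length (L + 1) / N. The overlap makes the
  excess over L^2 / N only a factor (L + 1) / L, whereas disjoint cells, L = 1, would lose a factor
  2.\<close>

lemma conv_wt_le:
  "(\<Sum>(i, j) | (i, j) \<in> {..<m} \<times> {..<m} \<and> i + j = n. wt i * wt j) \<le> ennreal (real L * (real L + 1) / real N)"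
proof -
  let ?P = "{(i, j). (i, j) \<in> {..<m} \<times> {..<m} \<and> i + j = n}"
  \<comment> \<open>Given l, the two floors add up to between n - l - L + 1 and n - l. Each floor
    drops less than 1, whence the upper end n - l + 2.\<close>
  define Z where "Z l = {(real n - real l - real L + 1) / real N ..< (real n - real l + 2) / real N}" for l
  have fin: "finite ?P" by (rule finite_subset[of _ "{..<m} \<times> {..<m}"]) auto
  have pt: "(\<Sum>(i, j)\<in>?P. h t * h t' * (indicator (bin i) t * indicator (bin j) t'))
      \<le> (\<Sum>l<L. h t * h t' * indicator (Z l) (t + t'))" for t t'
  proof (cases "t \<in> {0..1} \<and> t' \<in> {0..1}")
    case True
    let ?u = "nat \<lfloor>real N * t\<rfloor>" and ?u' = "nat \<lfloor>real N * t'\<rfloor>"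
    have u: "real ?u \<le> real N * t" "real N * t < real ?u + 1"
      "real ?u' \<le> real N * t'" "real N * t' < real ?u' + 1"
      using True by (auto simp: of_nat_floor mult_nonneg_nonneg real_of_int_floor_add_one_gt)
    have "card {x \<in> ?P. t \<in> bin (fst x) \<and> t' \<in> bin (snd x)} \<le> card {l \<in> {..<L}. t + t' \<in> Z l}"
    proof (rule card_inj_on_le[where f = "\<lambda>x. fst x - ?u"])
      show "inj_on (\<lambda>x. fst x - ?u) {x \<in> ?P. t \<in> bin (fst x) \<and> t' \<in> bin (snd x)}"
        by (rule inj_onI) (auto simp: bin_def; linarith)
      show "(\<lambda>x. fst x - ?u) ` {x \<in> ?P. t \<in> bin (fst x) \<and> t' \<in> bin (snd x)} \<subseteq> {l \<in> {..<L}. t + t' \<in> Z l}"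
      proof (rule image_subsetI)
        fix x assume "x \<in> {x \<in> ?P. t \<in> bin (fst x) \<and> t' \<in> bin (snd x)}"
        then obtain i j where x: "x = (i, j)" "i + j = n" "?u \<le> i" "i < ?u + L" "?u' \<le> j" "j < ?u' + L"
          by (auto simp: bin_def)
        have i: "real (i - ?u) = real i - real ?u" using x by simp
        have n: "real n = real i + real j" using x(2) by simp
        have "real j + 1 \<le> real ?u' + real L" "real ?u' \<le> real j"
          using x(5,6) by linarith+
        then have "real n - real (i - ?u) - real L + 1 \<le> real N * (t + t')"
          "real N * (t + t') < real n - real (i - ?u) + 2"
          using u unfolding i n distrib_left by linarith+
        then have "t + t' \<in> Z (i - ?u)" using N unfolding Z_def
          by (simp add: pos_divide_le_eq pos_less_divide_eq mult.commute)
        then show "fst x - ?u \<in> {l \<in> {..<L}. t + t' \<in> Z l}" using x by auto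
      qed
    qed simp
    then have "(of_nat (card {x \<in> ?P. t \<in> bin (fst x) \<and> t' \<in> bin (snd x)}) :: ennreal)
        \<le> of_nat (card {l \<in> {..<L}. t + t' \<in> Z l})" by simp
    also have "\<dots> = (\<Sum>l<L. indicator (Z l) (t + t'))"
      by (simp add: indicator_def sum.If_cases Int_def)
    also have "of_nat (card {x \<in> ?P. t \<in> bin (fst x) \<and> t' \<in> bin (snd x)})
       = (\<Sum>x\<in>?P. (indicator (bin (fst x)) t * indicator (bin (snd x)) t' :: ennreal))"
    proof -
      have "(\<Sum>x\<in>?P. (indicator (bin (fst x)) t * indicator (bin (snd x)) t' :: ennreal))
         = (\<Sum>x\<in>?P. if t \<in> bin (fst x) \<and> t' \<in> bin (snd x) then 1 else 0)"
        by (intro sum.cong) (auto simp: indicator_def)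
      also have "\<dots> = (\<Sum>x\<in>{x \<in> ?P. t \<in> bin (fst x) \<and> t' \<in> bin (snd x)}. 1)"
        using fin by (intro sum.inter_filter[symmetric])
      finally show ?thesis by simp
    qed
    finally show ?thesis
      by (simp only: case_prod_unfold sum_distrib_left[symmetric] mult_left_mono zero_le)
  next
    case False
    then have "h t * h t' = 0" using h_out by auto
    then show ?thesis by (simp only: case_prod_unfold mult_zero_left sum.neutral_const zero_le)
  qed
  have "(\<Sum>(i, j)\<in>?P. wt i * wt j)
      = (\<Sum>(i, j)\<in>?P. \<integral>\<^sup>+t. (\<integral>\<^sup>+t'. h t * h t' * (indicator (bin i) t * indicator (bin j) t') \<partial>lborel) \<partial>lborel)"
  proof (intro sum.cong refl, clarify)
    fix i j
    have "(\<integral>\<^sup>+t. (\<integral>\<^sup>+t'. h t * h t' * (indicator (bin i) t * indicator (bin j) t') \<partial>lborel) \<partial>lborel)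
       = (\<integral>\<^sup>+t. (\<integral>\<^sup>+t'. (h t * indicator (bin i) t) * (h t' * indicator (bin j) t') \<partial>lborel) \<partial>lborel)"
      by (intro nn_integral_cong) (simp add: mult_ac)
    also have "\<dots> = (\<integral>\<^sup>+t. (h t * indicator (bin i) t) * wt j \<partial>lborel)"
      unfolding wt_def by (intro nn_integral_cong nn_integral_cmult) measurable
    also have "\<dots> = wt i * wt j" unfolding wt_def[of i] by (rule nn_integral_multc) measurable
    finally show "wt i * wt j = (\<integral>\<^sup>+t. (\<integral>\<^sup>+t'. h t * h t' * (indicator (bin i) t * indicator (bin j) t') \<partial>lborel) \<partial>lborel)" ..
  qed
  also have "\<dots> = (\<integral>\<^sup>+t. (\<integral>\<^sup>+t'. (\<Sum>(i, j)\<in>?P. h t * h t' * (indicator (bin i) t * indicator (bin j) t')) \<partial>lborel) \<partial>lborel)"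
    unfolding case_prod_unfold by (rule nn_integral2_sum[symmetric]) measurable
  also have "\<dots> \<le> (\<integral>\<^sup>+t. (\<integral>\<^sup>+t'. (\<Sum>l<L. h t * h t' * indicator (Z l) (t + t')) \<partial>lborel) \<partial>lborel)"
    by (intro nn_integral_mono pt)
  also have "\<dots> = (\<Sum>l<L. \<integral>\<^sup>+t. (\<integral>\<^sup>+t'. h t * h t' * indicator (Z l) (t + t') \<partial>lborel) \<partial>lborel)"
    unfolding Z_def by (rule nn_integral2_sum) measurable
  also have "\<dots> \<le> (\<Sum>l<L. ennreal ((real L + 1) / real N))"
  proof (intro sum_mono)
    fix l
    have "(\<integral>\<^sup>+t. (\<integral>\<^sup>+t'. h t * h t' * indicator (Z l) (t + t') \<partial>lborel) \<partial>lborel)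
       \<le> ennreal ((real n - real l + 2) / real N - (real n - real l - real L + 1) / real N)"
      unfolding Z_def by (rule window_le) (intro divide_right_mono, auto)
    also have "(real n - real l + 2) / real N - (real n - real l - real L + 1) / real N = (real L + 1) / real N"
      by (simp add: diff_divide_distrib[symmetric])
    finally show "(\<integral>\<^sup>+t. (\<integral>\<^sup>+t'. h t * h t' * indicator (Z l) (t + t') \<partial>lborel) \<partial>lborel) \<le> ennreal ((real L + 1) / real N)" .
  qed
  also have "\<dots> = ennreal (real L * (real L + 1) / real N)"
    by (simp add: ennreal_of_nat_eq_real_of_nat flip: ennreal_mult)
  finally show ?thesis .
qed

end

text \<open>The windowed weights have total L I and convolution at most L (L + 1) / N. With N = L^2
  and M = L (L + 1) indices, the ratio (total)^2 / (bound times M) is at least (I L / (L + 1))^2,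
  which exceeds c^2 for large L. Scaling by a large K before rounding down preserves the strict
  inequality.\<close>

lemma sigma_discretised:
  assumes c: "0 \<le> c" "c < sigma_const"
  shows "\<exists>(N :: nat) (F :: nat) (\<phi> :: nat \<Rightarrow> nat) (h :: real). N \<ge> 1 \<and> (\<forall>i. \<phi> i \<le> F) \<and> h > 0 \<and>
    (\<forall>n. real (\<Sum>(i, j) | (i, j) \<in> {..<N} \<times> {..<N} \<and> i + j = n. \<phi> i * \<phi> j) \<le> h) \<and>
    c\<^sup>2 * (h * real N) < (real (\<Sum>i<N. \<phi> i))\<^sup>2"
proof -
  obtain f where f: "admissible f" "c < (LINT t:{0..1}|lebesgue. f t)"
    using c(2) less_cSup_iff[OF sigma_set_bdd_nonempty(2,1)] unfolding sigma_const_def by auto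
  define I where "I = (LINT t:{0..1}|lebesgue. f t)"
  have I: "c < I" "I > 0" using f(2) c(1) by (simp_all add: I_def)
  obtain g :: "real \<Rightarrow> ennreal" where g': "g \<in> borel_measurable borel \<and> (\<forall>x. x \<notin> {0..1} \<longrightarrow> g x = 0) \<and>
    (\<integral>\<^sup>+t. g t \<partial>lborel) = ennreal I \<and> (\<forall>x. (\<integral>\<^sup>+t. g t * g (x - t) \<partial>lborel) \<le> 1)"
    by (rule exE[OF admissible_borel_version[OF f(1), folded I_def]])
  have g: "g \<in> borel_measurable borel" "\<And>x. x \<notin> {0..1} \<Longrightarrow> g x = 0"
    "(\<integral>\<^sup>+t. g t \<partial>lborel) = ennreal I" "\<And>x. (\<integral>\<^sup>+t. g t * g (x - t) \<partial>lborel) \<le> 1"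
    using g' by blast+
  \<comment> \<open>Equivalent to c (L + 1) < L I.\<close>
  obtain L :: nat where L0: "c / (I - c) < real L" using reals_Archimedean2 by blast
  have "0 \<le> c / (I - c)" using c(1) I by simp
  then have "0 < real L" using L0 by linarith
  then have L1: "L \<ge> 1" by simp
  have "c < real L * (I - c)" using L0 I by (simp add: pos_divide_less_eq)
  then have L: "real L * I - c * (real L + 1) > 0" by (simp add: algebra_simps)
  define N where "N = L\<^sup>2"
  have N: "N > 0" using L1 by (simp add: N_def)
  define M where "M = N + L"
  have M: "real M = real L * (real L + 1)" by (simp add: M_def N_def power2_eq_square algebra_simps)
  define w where "w i = enn2real (wt g N L i)" for i
  have "wt g N L i \<le> ennreal I" for i
    using wt_le[OF g(1,2,4) N] unfolding g(3) .
  then have w: "wt g N L i = ennreal (w i)" for i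
    unfolding w_def by (metis ennreal_enn2real ennreal_less_top le_less_trans)
  have w0: "w i \<ge> 0" for i by (simp add: w_def)
  have sum_w: "(\<Sum>i<M. w i) = real L * I"
  proof -
    have "ennreal (\<Sum>i<M. w i) = (\<Sum>i<M. wt g N L i)" unfolding w using w0 by simp
    also have "\<dots> = of_nat L * ennreal I" using sum_wt[OF g(1,2,4) N, of L] unfolding M_def g(3) .
    also have "\<dots> = ennreal (real L * I)" using I by (simp add: ennreal_mult ennreal_of_nat_eq_real_of_nat)
    finally show ?thesis using w0 I by (simp add: ennreal_inj sum_nonneg)
  qed
  have conv_w: "(\<Sum>(i, j) | (i, j) \<in> {..<M} \<times> {..<M} \<and> i + j = n. w i * w j) \<le> real L * (real L + 1) / real N" for n
  proof -
    have "ennreal (\<Sum>(i, j) | (i, j) \<in> {..<M} \<times> {..<M} \<and> i + j = n. w i * w j)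
       = (\<Sum>(i, j) | (i, j) \<in> {..<M} \<times> {..<M} \<and> i + j = n. wt g N L i * wt g N L j)"
      unfolding w case_prod_unfold using w0 by (simp add: ennreal_mult flip: sum_ennreal)
    also have "\<dots> \<le> ennreal (real L * (real L + 1) / real N)" by (rule conv_wt_le[OF g(1,2,4) N])
    finally show ?thesis by (subst (asm) ennreal_le_iff) auto
  qed
  \<comment> \<open>Rounding loses at most 1 at each of M = L (L + 1) indices; the gap K (L I - c (L
    + 1)) must exceed this.\<close>
  obtain K :: nat where K0: "real L * (real L + 1) / (real L * I - c * (real L + 1)) < real K"
    using reals_Archimedean2 by blast
  then have K: "real L * (real L + 1) < real K * (real L * I - c * (real L + 1))"
    using L by (simp add: pos_divide_less_eq)
  have "0 \<le> real L * (real L + 1) / (real L * I - c * (real L + 1))" using L by simp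
  then have K1: "K > 0" using K0 by linarith
  define \<phi> where "\<phi> i = (if i < M then nat \<lfloor>real K * w i\<rfloor> else 0)" for i
  define h where "h = (real K)\<^sup>2 * (real L * (real L + 1) / real N)"
  have \<phi>_le: "real (\<phi> i) \<le> real K * w i" for i
    using w0 by (simp add: \<phi>_def of_nat_floor)
  show ?thesis
  \<comment> \<open>The total of the weights serves as the uniform bound; the weights vanish from
    index M on.\<close>
  proof (rule exI[of _ M], rule exI[of _ "\<Sum>i<M. \<phi> i"], rule exI[of _ \<phi>], rule exI[of _ h], intro conjI allI)
    show "M \<ge> 1" using N by (simp add: M_def)
    show "\<phi> i \<le> (\<Sum>i<M. \<phi> i)" for i
      by (cases "i < M") (auto simp: \<phi>_def intro: member_le_sum)
    show "h > 0" unfolding h_def using K1 N L1 by simp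
    show "real (\<Sum>(i, j) | (i, j) \<in> {..<M} \<times> {..<M} \<and> i + j = n. \<phi> i * \<phi> j) \<le> h" for n
    proof -
      have "real (\<Sum>(i, j) | (i, j) \<in> {..<M} \<times> {..<M} \<and> i + j = n. \<phi> i * \<phi> j)
        = (\<Sum>(i, j) | (i, j) \<in> {..<M} \<times> {..<M} \<and> i + j = n. real (\<phi> i) * real (\<phi> j))"
        by (simp add: case_prod_unfold)
      also have "\<dots> \<le> (\<Sum>(i, j) | (i, j) \<in> {..<M} \<times> {..<M} \<and> i + j = n. (real K * w i) * (real K * w j))"
        unfolding case_prod_unfold by (intro sum_mono mult_mono \<phi>_le) (auto simp: w0)
      also have "\<dots> = (real K)\<^sup>2 * (\<Sum>(i, j) | (i, j) \<in> {..<M} \<times> {..<M} \<and> i + j = n. w i * w j)"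
        unfolding case_prod_unfold sum_distrib_left by (intro sum.cong refl) (simp add: power2_eq_square)
      also have "\<dots> \<le> h" unfolding h_def by (intro mult_left_mono conv_w) simp
      finally show ?thesis .
    qed
    have "h * real M = ((real K) * (real L + 1))\<^sup>2"
      unfolding h_def M N_def using L1 by (simp add: power2_eq_square field_simps)
    then have "c\<^sup>2 * (h * real M) = (c * (real K * (real L + 1)))\<^sup>2" by (simp add: power_mult_distrib)
    also have "\<dots> < (real (\<Sum>i<M. \<phi> i))\<^sup>2"
    proof (rule power_strict_mono)
      have "real K * (real L * I) - real M = (\<Sum>i<M. real K * w i - 1)"
        by (simp add: sum_subtractf sum_w flip: sum_distrib_left)
      also have "\<dots> \<le> (\<Sum>i<M. real (\<phi> i))"
      proof (intro sum_mono)
        fix i assume "i \<in> {..<M}"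
        then show "real K * w i - 1 \<le> real (\<phi> i)" unfolding \<phi>_def by simp linarith
      qed
      finally show "c * (real K * (real L + 1)) < real (\<Sum>i<M. \<phi> i)"
        using K unfolding M by (simp add: algebra_simps)
    qed (use c(1) in auto)
    finally show "c\<^sup>2 * (h * real M) < (real (\<Sum>i<M. \<phi> i))\<^sup>2" .
  qed
qed

section \<open>The lower bound\<close>

text \<open>For given g and n, the construction is used with a prime p within a factor 32 of Y / k,
  where Y = sqrt (n / N), then s = floor (Y / p), and M as large as g allows. All of s, M and p - 1
  are at least k > 1 / \<delta>, so each rounding costs a factor of at most 1 + \<delta>.\<close>

lemma lower_beta_ge:
  assumes c: "0 \<le> c" "c < sigma_const"
  shows "\<forall>\<^sub>F g in sequentially. ereal (c * sqrt (real g)) \<le> lower_beta g"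
proof -
  obtain N F :: nat and \<phi> :: "nat \<Rightarrow> nat" and h :: real
    where N: "N \<ge> 1" and F: "\<And>i. \<phi> i \<le> F" and h: "h > 0"
    and conv: "\<And>n. real (\<Sum>(i, j) | (i, j) \<in> {..<N} \<times> {..<N} \<and> i + j = n. \<phi> i * \<phi> j) \<le> h"
    and large: "c\<^sup>2 * (h * real N) < (real (\<Sum>i<N. \<phi> i))\<^sup>2"
    using sigma_discretised[OF c] by blast
  define S where "S = real (\<Sum>i<N. \<phi> i)"
  \<comment> \<open>The exponent 11 = 4 + 4 + 2 + 1 collects the losses from (s + 1)^4, (M + 1)^4,
    p^2 against (p - 1)^2, and the factor 1 + \<delta> in the condition on g.\<close>
  have "((\<lambda>\<delta>. c\<^sup>2 * (h * real N) * (1 + \<delta>) ^ 11) \<longlongrightarrow> c\<^sup>2 * (h * real N) * (1 + 0) ^ 11) (at_right 0)"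
    by (intro tendsto_intros)
  then have "\<forall>\<^sub>F \<delta> in at_right 0. c\<^sup>2 * (h * real N) * (1 + \<delta>) ^ 11 < S\<^sup>2"
    by (rule order_tendstoD) (use large in \<open>simp add: S_def\<close>)
  then have "\<forall>\<^sub>F \<delta> in at_right (0::real). \<delta> > 0 \<and> c\<^sup>2 * (h * real N) * (1 + \<delta>) ^ 11 < S\<^sup>2"
    using eventually_at_right_less[of "0::real"] by eventually_elim simp
  then obtain \<delta> :: real where \<delta>: "\<delta> > 0" "c\<^sup>2 * (h * real N) * (1 + \<delta>) ^ 11 < S\<^sup>2"
    using eventually_happens'[OF trivial_limit_at_right_real] by blast
  define con where "con M p \<longleftrightarrow> (\<forall>s g. prime p \<longrightarrow> s > 0 \<longrightarrow>
      real ((s + 1)\<^sup>2) * (real M ^ 4 * h * (1 + \<delta>)) \<le> real g \<longrightarrow>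
      (\<exists>B. B \<subseteq> {1..int (p\<^sup>2 * s\<^sup>2 * N)} \<and> card B = M\<^sup>2 * (\<Sum>i<N. \<phi> i) * (p - 1) * s\<^sup>2 \<and> sidon g B))" for M p
  have "\<exists>M0. \<forall>M\<ge>M0. \<exists>P0. \<forall>p\<ge>P0. con M p"
    unfolding con_def by (rule sidon_from_weights[OF F N h \<delta>(1) conv])
  then obtain M0 P0 where construct: "\<And>M p. M \<ge> M0 \<Longrightarrow> p \<ge> P0 M \<Longrightarrow> con M p"
    by metis
  obtain k :: nat where k: "1 / \<delta> < real k" using reals_Archimedean2 by blast
  have k0: "real k > 0" using k \<delta>(1) by (smt (verit) divide_pos_pos)
  have step: "real x + 1 \<le> (1 + \<delta>) * real x" if "x \<ge> k" for x
  proof -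
    have "1 / \<delta> \<le> real x" using k that by linarith
    then have "1 \<le> \<delta> * real x" using \<delta>(1) by (simp add: field_simps)
    then show ?thesis by (simp add: algebra_simps)
  qed
  define M1 where "M1 = max M0 k"
  define X where "X g s = real g / (real ((s + 1)\<^sup>2) * (h * (1 + \<delta>)))" for g s :: nat
  \<comment> \<open>This is what M \<ge> \<open>M1\<close> requires for the largest possible s,
    namely 32 k; the condition does not involve n.\<close>
  have "\<forall>\<^sub>F g in sequentially. real ((32 * k + 1)\<^sup>2) * (h * (1 + \<delta>)) * real M1 ^ 4 \<le> real g"
    using filterlim_real_sequentially unfolding filterlim_at_top by blast
  then show ?thesis
  proof eventually_elim
    case (elim g)
    \<comment> \<open>M never exceeds the fourth root of g / h, whatever s is. Hence only finitely
      many thresholds \<open>P0 M\<close> occur for this g, and their maximum works for all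
      n.\<close>
    define Q where "Q = Max (P0 ` {..nat \<lfloor>root 4 (real g / h)\<rfloor>})"
    have "\<forall>\<^sub>F n in sequentially. real n \<ge> real N * (real k * 32 * (real Q + real k + 4 ^ 6)) ^ 2"
      using filterlim_real_sequentially unfolding filterlim_at_top by blast
    then have "\<forall>\<^sub>F n in sequentially. ereal (c * sqrt (real g)) \<le> ereal (real (beta g n) / sqrt (real n))"
      using eventually_gt_at_top[of "0::nat"]
    proof eventually_elim
      case (elim n)
      have N0: "real N > 0" using N by simp
      define Y where "Y = sqrt (real n / real N)"
      have Y: "real k * 32 * (real Q + real k + 4 ^ 6) \<le> Y" unfolding Y_def
        using elim(1) N0 by (intro real_le_rsqrt) (simp add: pos_le_divide_eq mult.commute)
      then have y: "32 * (real Q + real k + 4 ^ 6) \<le> Y / real k"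
        using k0 by (simp add: pos_le_divide_eq mult_ac)
      then have "4 ^ 6 \<le> Y / real k" by simp
      from prime_within_factor_32[OF this] obtain p :: nat
        where p: "prime p" "Y / real k < 32 * real p" "real p \<le> Y / real k" by blast
      have pQ: "Q \<le> p" "k + 1 \<le> p"
      proof -
        have "real (Q + k + 4 ^ 6) < real p" using y p(2) by simp
        then have "Q + k + 4 ^ 6 < p" by (simp only: of_nat_less_iff)
        then show "Q \<le> p" "k + 1 \<le> p" by simp_all
      qed
      have p0: "real p > 0" using p(1) by (simp add: prime_gt_0_nat)
      \<comment> \<open>Since p \<le> Y / k < 32 p, the quotient Y / p lies in [k, 32 k): large
        enough for a small rounding loss, yet bounded independently of n.\<close>
      define s where "s = nat \<lfloor>Y / real p\<rfloor>"
      have "real k \<le> Y / real p" using p(3) p0 k0 by (simp add: field_simps)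
      then have sk: "k \<le> s" unfolding s_def by (simp add: le_nat_iff le_floor_iff)
      have s_le: "real s \<le> Y / real p" "Y / real p < real s + 1"
        using \<open>real k \<le> Y / real p\<close> unfolding s_def by linarith+
      have "Y / real p < 32 * real k" using p(2) p0 k0 by (simp add: field_simps)
      then have s32: "s \<le> 32 * k" using s_le(1) by linarith
      have n_eq: "real n = Y\<^sup>2 * real N" using N0 by (simp add: Y_def)
      have n_ge: "p\<^sup>2 * s\<^sup>2 * N \<le> n"
      proof -
        have "real s * real p \<le> Y" using s_le(1) p0 by (simp add: field_simps)
        then have "(real s * real p)\<^sup>2 \<le> Y\<^sup>2" by (intro power_mono) auto
        then have "real (p\<^sup>2 * s\<^sup>2 * N) \<le> real n" unfolding n_eq
          by (simp add: power_mult_distrib mult_ac mult_left_mono)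
        then show ?thesis by (simp only: of_nat_le_iff)
      qed
      have n_le: "real n \<le> ((real s + 1) * real p)\<^sup>2 * real N"
      proof -
        have "Y \<le> (real s + 1) * real p" using s_le(2) p0 by (simp add: field_simps)
        then show ?thesis unfolding n_eq by (intro mult_right_mono power_mono) (auto simp: Y_def)
      qed
      \<comment> \<open>The largest M satisfying the condition on g: \<open>X g s\<close> is the
        value of M^4 that would give equality.\<close>
      define M where "M = nat \<lfloor>root 4 (X g s)\<rfloor>"
      have H: "h * (1 + \<delta>) > 0" using h \<delta>(1) by simp
      have X0: "X g s \<ge> 0" unfolding X_def using H by simp
      have den: "real ((s + 1)\<^sup>2) * (h * (1 + \<delta>)) > 0" using H by simp
      have "real M1 ^ 4 \<le> X g s"
      proof -
        have "(s + 1)\<^sup>2 \<le> (32 * k + 1)\<^sup>2" using s32 by (intro power_mono) auto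
        then have "real ((s + 1)\<^sup>2) \<le> real ((32 * k + 1)\<^sup>2)" by (simp only: of_nat_le_iff)
        then have "real ((s + 1)\<^sup>2) * (h * (1 + \<delta>)) * real M1 ^ 4 \<le> real ((32 * k + 1)\<^sup>2) * (h * (1 + \<delta>)) * real M1 ^ 4"
          using H by (intro mult_right_mono) auto
        then have "real ((s + 1)\<^sup>2) * (h * (1 + \<delta>)) * real M1 ^ 4 \<le> real g"
          using \<open>_ \<le> real g\<close> by linarith
        then show ?thesis unfolding X_def using den by (simp add: pos_le_divide_eq mult.commute)
      qed
      then have "root 4 (real M1 ^ 4) \<le> root 4 (X g s)" by simp
      then have "real M1 \<le> root 4 (X g s)" by (simp add: real_root_power_cancel)
      then have MM1: "M1 \<le> M" unfolding M_def by linarith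
      have r0: "root 4 (X g s) \<ge> 0" using X0 by simp
      have M_le: "real M \<le> root 4 (X g s)" "root 4 (X g s) \<le> real M + 1"
        unfolding M_def using r0 by linarith+
      have M4: "real M ^ 4 \<le> X g s"
        using power_mono[OF M_le(1), of 4] X0 by simp
      have M5: "X g s \<le> (real M + 1) ^ 4"
        using power_mono[OF M_le(2) r0, of 4] X0 by simp
      have g_ge: "real ((s + 1)\<^sup>2) * (real M ^ 4 * h * (1 + \<delta>)) \<le> real g"
        using M4 den unfolding X_def by (simp only: pos_le_divide_eq) (simp only: mult_ac)
      have g_le: "real g \<le> (real s + 1)\<^sup>2 * ((real M + 1) ^ 4 * (h * (1 + \<delta>)))"
        using M5 den unfolding X_def by (simp add: pos_divide_le_eq mult_ac add.commute[of 1])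
      have "P0 M \<le> Q" unfolding Q_def
      proof (rule Max_ge)
        have "X g s \<le> real g / h" unfolding X_def
        proof (rule divide_left_mono)
          have "1 * (h * 1) \<le> real ((s + 1)\<^sup>2) * (h * (1 + \<delta>))"
            using h \<delta>(1) by (intro mult_mono) (auto simp: of_nat_le_iff[of 1, simplified])
          then show "h \<le> real ((s + 1)\<^sup>2) * (h * (1 + \<delta>))" by simp
        qed (use h den in auto)
        then have "M \<le> nat \<lfloor>root 4 (real g / h)\<rfloor>" unfolding M_def
          by (intro nat_mono floor_mono) simp
        then show "P0 M \<in> P0 ` {..nat \<lfloor>root 4 (real g / h)\<rfloor>}" by simp
      qed simp
      then have "con M p" using MM1 pQ by (intro construct) (simp_all add: M1_def)
      moreover have "s > 0" using sk k0 by linarith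
      ultimately obtain B where B: "B \<subseteq> {1..int (p\<^sup>2 * s\<^sup>2 * N)}"
          "card B = M\<^sup>2 * (\<Sum>i<N. \<phi> i) * (p - 1) * s\<^sup>2" "sidon g B"
        using p(1) g_ge unfolding con_def by blast
      have "int (p\<^sup>2 * s\<^sup>2 * N) \<le> int n" using n_ge by (simp only: of_nat_le_iff)
      then have "B \<subseteq> {1..int n}" using B(1) by force
      then have "card B \<le> beta g n" using B(3) by (rule beta_ge)
      have p1: "real (p - 1) = real p - 1" using pQ by (simp add: of_nat_diff)
      have cB: "real (card B) = real M ^ 2 * S * (real p - 1) * (real s)\<^sup>2"
        unfolding B(2) S_def of_nat_mult p1 by simp
      have "c\<^sup>2 * (real g * real n) \<le> c\<^sup>2 * (((real s + 1)\<^sup>2 * ((real M + 1) ^ 4 * (h * (1 + \<delta>)))) * (((real s + 1) * real p)\<^sup>2 * real N))"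
        using H by (intro mult_left_mono mult_mono g_le n_le) auto
      also have "\<dots> = c\<^sup>2 * (h * real N) * (1 + \<delta>) * ((real s + 1) ^ 4 * (real M + 1) ^ 4 * (real p)\<^sup>2)"
        by (simp add: power_mult_distrib power4_eq_xxxx power2_eq_square mult_ac)
      also have "\<dots> \<le> c\<^sup>2 * (h * real N) * (1 + \<delta>) *
          (((1 + \<delta>) * real s) ^ 4 * ((1 + \<delta>) * real M) ^ 4 * ((1 + \<delta>) * (real p - 1))\<^sup>2)"
      proof (intro mult_left_mono mult_mono power_mono)
        show "real s + 1 \<le> (1 + \<delta>) * real s" by (rule step[OF sk])
        show "real M + 1 \<le> (1 + \<delta>) * real M" by (rule step) (use MM1 in \<open>simp add: M1_def\<close>)
        have "real (p - 1) + 1 \<le> (1 + \<delta>) * real (p - 1)" by (rule step) (use pQ in simp)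
        then show "real p \<le> (1 + \<delta>) * (real p - 1)" unfolding p1 by simp
      qed (use h \<delta>(1) in auto)
      also have "\<dots> = c\<^sup>2 * (h * real N) * (1 + \<delta>) ^ 11 * (real M ^ 2 * (real p - 1) * (real s)\<^sup>2)\<^sup>2"
        by (simp add: power_mult_distrib flip: power_mult) (simp add: eval_nat_numeral mult_ac)
      also have "\<dots> \<le> S\<^sup>2 * (real M ^ 2 * (real p - 1) * (real s)\<^sup>2)\<^sup>2"
        using \<delta>(2) by (intro mult_right_mono) auto
      also have "\<dots> = (real (card B))\<^sup>2" unfolding cB by (simp add: power_mult_distrib)
      also have "\<dots> \<le> (real (beta g n))\<^sup>2"
        using \<open>card B \<le> beta g n\<close> by (intro power_mono) auto
      finally have "(c * sqrt (real g) * sqrt (real n))\<^sup>2 \<le> (real (beta g n))\<^sup>2"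
        by (simp add: power_mult_distrib)
      then have "c * sqrt (real g) * sqrt (real n) \<le> real (beta g n)"
        by (rule power2_le_imp_le) simp
      then show "ereal (c * sqrt (real g)) \<le> ereal (real (beta g n) / sqrt (real n))"
        using elim(2) by (simp add: pos_le_divide_eq)
    qed
    then show ?case unfolding lower_beta_def by (rule Liminf_bounded)
  qed
qed

text \<open>As \<open>lower_beta\<close> never exceeds \<open>upper_beta\<close>, an upper bound for
  the latter and an asymptotic lower bound for the former settle both limits.\<close>

theorem theorem1:
  shows "((\<lambda>g::nat. lower_beta g / ereal (sqrt (real g))) \<longlongrightarrow> ereal sigma_const) sequentially \<and>
         ((\<lambda>g::nat. upper_beta g / ereal (sqrt (real g))) \<longlongrightarrow> ereal sigma_const) sequentially"
proof -
  have le: "lower_beta g \<le> upper_beta g" for g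
    unfolding lower_beta_def upper_beta_def by (rule Liminf_le_Limsup) simp
  have up: "upper_beta g / ereal (sqrt (real g)) \<le> ereal sigma_const" if "g > 0" for g
    using upper_beta_le[OF that] that by (intro ereal_divide_le_pos[THEN iffD2]) (auto simp: mult.commute)
  have low0: "0 \<le> lower_beta g" for g
    unfolding lower_beta_def by (rule Liminf_bounded) simp
  have low: "\<forall>\<^sub>F g in sequentially. a < lower_beta g / ereal (sqrt (real g))" if a: "a < ereal sigma_const" for a
  proof (cases "a < 0")
    case True
    show ?thesis using eventually_gt_at_top[of "0::nat"]
      by (eventually_elim) (rule less_le_trans[OF True zero_le_divide_ereal[OF low0]], simp)
  next
    case False
    then obtain b where b: "a = ereal b" "0 \<le> b" "b < sigma_const" using a by (cases a) auto
    \<comment> \<open>A constant strictly between b and \<open>sigma_const\<close> turns the weak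
      inequality of \<open>lower_beta_ge\<close> into the strict one needed here.\<close>
    define c where "c = (b + sigma_const) / 2"
    have c: "b < c" "0 \<le> c" "c < sigma_const" using b by (auto simp: c_def)
    from lower_beta_ge[OF c(2,3)] show ?thesis using eventually_gt_at_top[of "0::nat"]
    proof eventually_elim
      case (elim g)
      have "a < ereal c" using b(1) c(1) by simp
      also have "ereal c \<le> lower_beta g / ereal (sqrt (real g))"
        using elim by (intro ereal_le_divide_pos[THEN iffD2]) (auto simp: mult.commute)
      finally show ?case .
    qed
  qed
  have mono: "lower_beta g / ereal (sqrt (real g)) \<le> upper_beta g / ereal (sqrt (real g))" if "g > 0" for g
    using le[of g] that by (intro ereal_divide_right_mono) auto
  have "((\<lambda>g. lower_beta g / ereal (sqrt (real g))) \<longlongrightarrow> ereal sigma_const) sequentially"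
  proof (rule order_tendstoI)
    fix a assume "ereal sigma_const < a"
    show "\<forall>\<^sub>F g in sequentially. lower_beta g / ereal (sqrt (real g)) < a"
      using eventually_gt_at_top[of "0::nat"]
      by eventually_elim (use up mono \<open>ereal sigma_const < a\<close> in \<open>blast intro: le_less_trans order_trans\<close>)
  qed (rule low)
  moreover have "((\<lambda>g. upper_beta g / ereal (sqrt (real g))) \<longlongrightarrow> ereal sigma_const) sequentially"
  proof (rule order_tendstoI)
    fix a assume "ereal sigma_const < a"
    show "\<forall>\<^sub>F g in sequentially. upper_beta g / ereal (sqrt (real g)) < a"
      using eventually_gt_at_top[of "0::nat"]
      by eventually_elim (use up \<open>ereal sigma_const < a\<close> in \<open>blast intro: le_less_trans\<close>)
  next
    fix a assume "a < ereal sigma_const"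
    from low[OF this] show "\<forall>\<^sub>F g in sequentially. a < upper_beta g / ereal (sqrt (real g))"
      using eventually_gt_at_top[of "0::nat"]
      by eventually_elim (use mono in \<open>blast intro: less_le_trans\<close>)
  qed
  ultimately show ?thesis ..
qed

end
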